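(* Let $n$ and $k$ be positive integers, and let $\hat0_n=\{\{1\},\ldots,\{n\}\}$. The map $$(\mathcal P_1,\mathcal P_2,\ldots,\mathcal P_{k-1})\mapsto\nabla(\hat0_n,\mathcal P_1,\mathcal P_2,\ldots,\mathcal P_{k-1})$$ is a bijection from the set of $(k-1)$-multichains $\mathcal P_1\leq\cdots\leq\mathcal P_{k-1}$ in $NC(n)$ to the set of noncrossing partitions of $[kn]$ in which each block has size $k$.
   Context: A partition of $[n]=\{1,\ldots,n\}$ is noncrossing if there are no $a<b<c<d$ with $a,c$ in one block and $b,d$ in a different block. $NC(n)$ is the lattice of noncrossing partitions of $[n]$ under refinement. Kreweras complement: for $\mathcal P\in NC(n)$, $K(\mathcal P)$ is the coarsest partition $\mathcal Q$ of $[n]$ such that the partition $(2\mathcal P-1)\cup(2\mathcal Q)$ of $[2n]$ is noncrossing (translations and dilations are applied elementwise to blocks). $K$ is a bijection (an anti-automorphism) of $NC(n)$. For a finite set $X$ of integers, $K_X$ is the Kreweras complement on noncrossing partitions of $X$, transported along the order-preserving bijection $X\leftrightarrow[|X|]$. For $\mathcal P\leq\mathcal N=\{N_1,\ldots,N_t\}$ in $NC(n)$, $K^{\mathcal N}(\mathcal P)=\bigcup_{i=1}^tK_{N_i}(\mathcal P|_{N_i})$. Shuffle: for partitions $\mathcal Q_1,\ldots,\mathcal Q_k$ of $[n]$, $\langle\mathcal Q_1,\ldots,\mathcal Q_k\rangle=\bigcup_{i=1}^k(k\mathcal Q_i-(k-i))$, a partition of $[kn]$. For a $k$-multichain $\mathcal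 P_1\leq\cdots\leq\mathcal P_k$ in $NC(n)$, $$\nabla(\mathcal P_1,\ldots,\mathcal P_k)=K^{-1}\big\langle K^{\mathcal P_2}(\mathcal P_1),\ldots,K^{\mathcal P_k}(\mathcal P_{k-1}),K(\mathcal P_k)\big\rangle,$$ where the outer $K^{-1}$ is the inverse of the Kreweras complement on $NC(kn)$. *)

theory Defs
  imports "HOL-Library.Disjoint_Sets"
begin

definition noncrossing :: "'a::linorder set set \<Rightarrow> bool" where
  "noncrossing P \<longleftrightarrow>
     \<not> (\<exists>A\<in>P. \<exists>B\<in>P. A \<noteq> B \<and>
          (\<exists>a b c d. a < b \<and> b < c \<and> c < d \<and> a \<in> A \<and> c \<in> A \<and> b \<in> B \<and> d \<in> B))"

definition NC :: "nat \<Rightarrow> nat set set set" where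
  "NC n = {P. partition_on {1..n} P \<and> noncrossing P}"

text \<open>\<open>refines P Q\<close> is the lattice order \<open>P \<le> Q\<close> (so \<open>Q\<close> is the coarser partition).\<close>

definition refines :: "'a set set \<Rightarrow> 'a set set \<Rightarrow> bool" where
  "refines P Q \<longleftrightarrow> (\<forall>A\<in>P. \<exists>B\<in>Q. A \<subseteq> B)"

definition map_blocks :: "('a \<Rightarrow> 'b) \<Rightarrow> 'a set set \<Rightarrow> 'b set set" where
  "map_blocks f P = (\<lambda>B. f ` B) ` P"

text \<open>
  All elements of the blocks are at least \<open>1\<close>, so the truncated subtractions below
  (\<open>2 * x - 1\<close> here, \<open>k * x - (k - Suc i)\<close> in \<open>shuffle_parts\<close>) agree with subtraction of integers.
\<close>

definition kreweras_compat :: "nat \<Rightarrow> nat set set \<Rightarrow> nat set set \<Rightarrow> bool" where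
  "kreweras_compat n P Q \<longleftrightarrow> partition_on {1..n} Q \<and>
     map_blocks (\<lambda>x. 2 * x - 1) P \<union> map_blocks (\<lambda>x. 2 * x) Q \<in> NC (2 * n)"

text \<open>``Coarsest'' means greatest with respect to refinement.\<close>

definition kreweras :: "nat \<Rightarrow> nat set set \<Rightarrow> nat set set" where
  "kreweras n P =
     (THE Q. kreweras_compat n P Q \<and> (\<forall>R. kreweras_compat n P R \<longrightarrow> refines R Q))"

text \<open>\<open>rank X\<close> is the order-preserving bijection from a finite set \<open>X\<close> to \<open>{1..card X}\<close>.\<close>

definition rank :: "'a::linorder set \<Rightarrow> 'a \<Rightarrow> nat" where
  "rank X x = card {y\<in>X. y \<le> x}"

lemma strict_mono_on_rank: "finite X \<Longrightarrow> strict_mono_on X (rank X)"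
  unfolding rank_def by (rule strict_mono_onI, rule psubset_card_mono) force+

lemma bij_betw_rank:
  assumes "finite X"
  shows "bij_betw (rank X) X {1..card X}"
proof -
  have inj: "inj_on (rank X) X"
    using strict_mono_on_rank[OF assms] by (rule strict_mono_on_imp_inj_on)
  have "1 \<le> rank X x \<and> rank X x \<le> card X" if "x \<in> X" for x
  proof -
    have "{y\<in>X. y \<le> x} \<noteq> {}" using that by blast
    then have "0 < rank X x" using assms by (simp add: rank_def card_gt_0_iff)
    moreover have "rank X x \<le> card X" unfolding rank_def by (rule card_mono) (use assms in auto)
    ultimately show ?thesis by simp
  qed
  then have "rank X ` X \<subseteq> {1..card X}" by auto
  then have "rank X ` X = {1..card X}"
    by (rule card_subset_eq[rotated]) (simp_all add: card_image[OF inj])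
  with inj show ?thesis by (simp add: bij_betw_def)
qed

definition kreweras_on :: "'a::linorder set \<Rightarrow> 'a set set \<Rightarrow> 'a set set" where
  "kreweras_on X P =
     map_blocks (inv_into X (rank X)) (kreweras (card X) (map_blocks (rank X) P))"

definition restrict_blocks :: "'a set set \<Rightarrow> 'a set \<Rightarrow> 'a set set" where
  "restrict_blocks P X = (\<lambda>B. B \<inter> X) ` P - {{}}"

text \<open>\<open>kreweras_rel N P\<close> is the relative complement \<open>K\<^sup>N(P)\<close>, for \<open>P \<le> N\<close>.\<close>

definition kreweras_rel :: "nat set set \<Rightarrow> nat set set \<Rightarrow> nat set set" where
  "kreweras_rel N P = (\<Union>X\<in>N. kreweras_on X (restrict_blocks P X))"

text \<open>Lists are indexed from \<open>0\<close>: the entry \<open>Qs ! i\<close> is the \<open>(i + 1)\<close>-st partition.\<close>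

definition shuffle_parts :: "nat set set list \<Rightarrow> nat set set" where
  "shuffle_parts Qs =
     (let k = length Qs
      in \<Union>i<k. map_blocks (\<lambda>x. k * x - (k - Suc i)) (Qs ! i))"

definition multichains :: "nat \<Rightarrow> nat \<Rightarrow> nat set set list set" where
  "multichains n k = {Ps. length Ps = k \<and> set Ps \<subseteq> NC n \<and> sorted_wrt refines Ps}"

text \<open>
  Only meaningful for nonempty \<open>Ps\<close>; \<open>map2\<close> pairs each entry of the multichain but the last
  with its successor.
\<close>

definition nabla :: "nat \<Rightarrow> nat set set list \<Rightarrow> nat set set" where
  "nabla n Ps =
     (let m = length Ps * n
      in inv_into (NC m) (kreweras m)
           (shuffle_parts
              (map2 (\<lambda>P N. kreweras_rel N P) (butlast Ps) (tl Ps) @ [kreweras n (last Ps)])))"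

definition bot_part :: "nat \<Rightarrow> nat set set" where
  "bot_part n = (\<lambda>i. {i}) ` {1..n}"

end

theory Submission
  imports Defs
begin

text \<open>
  Write a partition as an equivalence relation, and call a pair of equivalent elements a chord. Put a
  gap \<open>x'\<close> just after each point \<open>x\<close>. A partition \<open>Q\<close> of the gaps is compatible with a noncrossing
  partition \<open>P\<close> of the points iff \<open>Q\<close> is noncrossing and gaps in one block of \<open>Q\<close> lie under the same
  chords of \<open>P\<close>. So \<open>K P\<close> is the partition of the gaps by the set of chords of \<open>P\<close> above them
  (\<open>gap_equiv\<close>, \<open>kreweras_characterization\<close>), and the relative complement is the meet
  \<open>K\<^sup>N(P) = N \<and> K P\<close> (\<open>kreweras_rel_characterization\<close>). Dually, \<open>P\<close> is recovered from \<open>N\<close> and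
  \<open>Q = K\<^sup>N(P)\<close> by grouping points of one block of \<open>N\<close> by the chords of \<open>Q\<close> above them (\<open>point_equiv\<close>,
  \<open>same_block_recover\<close>). Hence \<open>K\<^sup>N\<close> is an injective self-map of the finite set of noncrossing
  partitions below \<open>N\<close>, and so a bijection.

  A shuffle of \<open>Q\<^sub>1, ..., Q\<^sub>k\<close> is noncrossing iff every \<open>Q\<^sub>i\<close> is and, for \<open>i < j\<close>, no chord of \<open>Q\<^sub>i\<close>
  crosses a chord of \<open>Q\<^sub>j\<close> when the former sits at points and the latter at gaps
  (\<open>noncrossing_shuffle_parts_iff\<close>). For a multichain \<open>P\<^sub>0 \<le> ... \<le> P\<^sub>k\<close> ending in the one-block
  partition, the complements \<open>Q\<^sub>i = P\<^sub>i \<and> K P\<^bsub>i-1\<^esub>\<close> have this property. Conversely, given such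
  \<open>Q\<^sub>1, ..., Q\<^sub>k\<close> one finds \<open>P\<^bsub>k-1\<^esub>, ..., P\<^sub>0\<close> from the top down, inverting one relative complement at a
  time (\<open>multichain_exists\<close>). So multichains of length \<open>k\<close> correspond to noncrossing shuffles, that
  is, to the noncrossing partitions of \<open>[kn]\<close> in which elements of the same block are congruent modulo
  \<open>k\<close>.

  It remains to see which \<open>R \<in> NC(kn)\<close> with \<open>K R\<close> a shuffle come from \<open>P\<^sub>0 = 0\<close>, the
  partition into singletons. If all blocks of
  \<open>R\<close> have size \<open>k\<close>, then \<open>K R\<close> relates only congruent gaps, because the points between two related
  gaps form a union of blocks (\<open>kreweras_residues_of_block_sizes\<close>). Whenever \<open>K R\<close> relates only
  congruent gaps, each element of a block of \<open>R\<close> is congruent to the cyclically preceding one plus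
  \<open>1\<close>, so a block has size \<open>k\<close> iff it contains at most one element congruent to \<open>1\<close>
  (\<open>card_block_iff\<close>). But the restriction of \<open>R\<close> to the elements congruent to \<open>1\<close> is a copy of \<open>P\<^sub>0\<close>
  (\<open>same_block_first_residue\<close>), because iterating the recovery of \<open>P\<^bsub>i-1\<^esub>\<close> from \<open>P\<^sub>i\<close> and \<open>Q\<^sub>i\<close> says that
  \<open>P\<^sub>0\<close> groups the points by the chords of all \<open>Q\<^sub>i\<close> above them. Hence all blocks have size \<open>k\<close> iff
  \<open>P\<^sub>0 = 0\<close>.
\<close>

section \<open>Partitions as equivalence relations\<close>

definition same_block :: "'a set set \<Rightarrow> 'a \<Rightarrow> 'a \<Rightarrow> bool" where
  "same_block P a b \<longleftrightarrow> (\<exists>B\<in>P. a \<in> B \<and> b \<in> B)"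

lemma same_block_sym: "same_block P a b \<Longrightarrow> same_block P b a"
  by (auto simp: same_block_def)

lemma same_block_trans:
  assumes "partition_on A P" "same_block P a b" "same_block P b c"
  shows "same_block P a c"
  using assms unfolding same_block_def partition_on_def disjoint_def by blast

lemma same_block_refl_iff: "partition_on A P \<Longrightarrow> same_block P a a \<longleftrightarrow> a \<in> A"
  unfolding same_block_def partition_on_def by blast

lemma same_block_in:
  assumes "partition_on A P" "same_block P a b"
  shows "a \<in> A" "b \<in> A"
  using assms unfolding same_block_def partition_on_def by blast+

lemma block_eq_Collect:
  assumes "partition_on A P" "B \<in> P" "a \<in> B"
  shows "B = {b. same_block P a b}"
  using assms unfolding same_block_def partition_on_def disjoint_def by blast

lemma same_block_eqD:
  assumes "partition_on A P" "B \<in> P" "C \<in> P" "b \<in> B" "c \<in> C" "same_block P b c"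
  shows "B = C"
proof -
  obtain D where D: "D \<in> P" "b \<in> D" "c \<in> D" using assms(6) unfolding same_block_def by blast
  show ?thesis
    using block_eq_Collect[OF assms(1,2,4)] block_eq_Collect[OF assms(1) D(1,2)]
      block_eq_Collect[OF assms(1,3,5)] block_eq_Collect[OF assms(1) D(1,3)] by simp
qed

lemma partition_on_eqI:
  assumes P: "partition_on A P" and Q: "partition_on A Q"
    and eq: "\<And>a b. same_block P a b \<longleftrightarrow> same_block Q a b"
  shows "P = Q"
proof -
  have "P \<subseteq> Q" if P: "partition_on A P" and Q: "partition_on A Q"
    and eq: "\<And>a b. same_block P a b \<longleftrightarrow> same_block Q a b" for P Q :: "'a set set"
  proof
    fix B assume B: "B \<in> P"
    then obtain a where a: "a \<in> B" using partition_onD3[OF P] by fastforce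
    then have "a \<in> A" using P B unfolding partition_on_def by blast
    then obtain C where C: "C \<in> Q" "a \<in> C" using Q unfolding partition_on_def by blast
    show "B \<in> Q"
      using block_eq_Collect[OF P B a] block_eq_Collect[OF Q C] eq C by simp
  qed
  from this[OF P Q eq] this[OF Q P eq[symmetric]] show ?thesis by blast
qed

lemma refines_iff_same_block:
  assumes P: "partition_on A P" and Q: "partition_on A Q"
  shows "refines P Q \<longleftrightarrow> (\<forall>a b. same_block P a b \<longrightarrow> same_block Q a b)"
proof
  show "refines P Q \<Longrightarrow> \<forall>a b. same_block P a b \<longrightarrow> same_block Q a b"
    unfolding refines_def same_block_def by (meson subsetD)
next
  assume le: "\<forall>a b. same_block P a b \<longrightarrow> same_block Q a b"
  show "refines P Q"
    unfolding refines_def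
  proof
    fix B assume B: "B \<in> P"
    then obtain a where a: "a \<in> B" using partition_onD3[OF P] by fastforce
    then have "a \<in> A" using P B unfolding partition_on_def by blast
    then obtain C where C: "C \<in> Q" "a \<in> C" using Q unfolding partition_on_def by blast
    have "B \<subseteq> C"
      by (subst block_eq_Collect[OF P B a], subst block_eq_Collect[OF Q C]) (use le in blast)
    then show "\<exists>C\<in>Q. B \<subseteq> C" using C(1) by blast
  qed
qed

lemma noncrossing_iff_same_block:
  assumes P: "partition_on A P"
  shows "noncrossing P \<longleftrightarrow> (\<forall>a b c d. a < b \<longrightarrow> b < c \<longrightarrow> c < d \<longrightarrow>
           same_block P a c \<longrightarrow> same_block P b d \<longrightarrow> same_block P a b)"
proof
  assume nc: "noncrossing P"
  show "\<forall>a b c d. a < b \<longrightarrow> b < c \<longrightarrow> c < d \<longrightarrow>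
           same_block P a c \<longrightarrow> same_block P b d \<longrightarrow> same_block P a b"
  proof (intro allI impI)
    fix a b c d
    assume less: "a < b" "b < c" "c < d" and ac: "same_block P a c" and bd: "same_block P b d"
    obtain X where X: "X \<in> P" "a \<in> X" "c \<in> X" using ac by (auto simp: same_block_def)
    obtain Y where Y: "Y \<in> P" "b \<in> Y" "d \<in> Y" using bd by (auto simp: same_block_def)
    have "X = Y"
    proof (rule ccontr)
      assume "X \<noteq> Y"
      with less X Y have "a < b \<and> b < c \<and> c < d \<and> a \<in> X \<and> c \<in> X \<and> b \<in> Y \<and> d \<in> Y" by simp
      then have "\<exists>a b c d. a < b \<and> b < c \<and> c < d \<and> a \<in> X \<and> c \<in> X \<and> b \<in> Y \<and> d \<in> Y" by (intro exI)
      with X(1) Y(1) \<open>X \<noteq> Y\<close> have "\<not> noncrossing P"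
        unfolding noncrossing_def not_not by (intro bexI[of _ X] bexI[of _ Y] conjI)
      with nc show False by contradiction
    qed
    then show "same_block P a b" using X Y unfolding same_block_def by blast
  qed
next
  assume *: "\<forall>a b c d. a < b \<longrightarrow> b < c \<longrightarrow> c < d \<longrightarrow>
           same_block P a c \<longrightarrow> same_block P b d \<longrightarrow> same_block P a b"
  show "noncrossing P"
    unfolding noncrossing_def
  proof (rule notI, elim bexE conjE exE)
    fix X Y a b c d
    assume X: "X \<in> P" and Y: "Y \<in> P" and "X \<noteq> Y" "a < b" "b < c" "c < d"
      and in_blocks: "a \<in> X" "c \<in> X" "b \<in> Y" "d \<in> Y"
    have "same_block P a c" "same_block P b d"
      using X Y in_blocks unfolding same_block_def by blast+
    then have "same_block P a b"
      using * \<open>a < b\<close> \<open>b < c\<close> \<open>c < d\<close> by blast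
    then show False
      using same_block_eqD[OF P X Y in_blocks(1,3)] \<open>X \<noteq> Y\<close> by blast
  qed
qed

lemma noncrossingD:
  assumes "noncrossing P" "partition_on A P"
    and "a < b" "b < c" "c < d" "same_block P a c" "same_block P b d"
  shows "same_block P a b"
  using assms noncrossing_iff_same_block by blast

lemma partition_of_equivalence:
  assumes "\<And>x. x \<in> X \<Longrightarrow> R x x" "\<And>x y. R x y \<Longrightarrow> R y x" "\<And>x y z. R x y \<Longrightarrow> R y z \<Longrightarrow> R x z"
  shows "\<exists>Q. partition_on X Q \<and> (\<forall>x y. same_block Q x y \<longleftrightarrow> x \<in> X \<and> y \<in> X \<and> R x y)"
proof (intro exI conjI allI)
  define r where "r = {(x, y). x \<in> X \<and> y \<in> X \<and> R x y}"
  have r: "equiv X r"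
    by (rule equivI) (auto simp: r_def refl_on_def intro!: symI transI assms(1) dest: assms(2) elim: assms(3))
  show "partition_on X (X // r)" using r by (rule partition_on_quotient)
  fix x y
  have "same_block (X // r) x y \<longleftrightarrow> (x, y) \<in> r"
  proof
    assume "same_block (X // r) x y"
    then obtain B where "B \<in> X // r" "x \<in> B" "y \<in> B" unfolding same_block_def by blast
    then show "(x, y) \<in> r" using quotient_eq_iff[OF r, of B B x y] by blast
  next
    assume xy: "(x, y) \<in> r"
    then have "x \<in> X" by (simp add: r_def)
    then have "r `` {x} \<in> X // r" "x \<in> r `` {x}"
      using equiv_class_self[OF r] by (auto intro: quotientI)
    then show "same_block (X // r) x y" using xy unfolding same_block_def by blast
  qed
  then show "same_block (X // r) x y \<longleftrightarrow> x \<in> X \<and> y \<in> X \<and> R x y" by (simp add: r_def)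
qed

section \<open>Chords, gaps and points\<close>

text \<open>
  A chord \<open>a\<close>, \<open>c\<close> passes over the gap after \<open>x\<close> iff exactly one of its ends is beyond \<open>x\<close>, so two gaps
  are related iff the same chords of \<open>P\<close> pass over them. In this form, the relation is visibly
  equality of two functions of the chord, hence an equivalence relation.
\<close>

definition gap_equiv :: "'a::linorder set set \<Rightarrow> 'a \<Rightarrow> 'a \<Rightarrow> bool" where
  "gap_equiv P x y \<longleftrightarrow>
     (\<forall>a c. same_block P a c \<longrightarrow> ((x < a \<longleftrightarrow> x < c) \<longleftrightarrow> (y < a \<longleftrightarrow> y < c)))"

text \<open>
  The dual notion: here the chords join gaps, the gap after \<open>b\<close> is to the left of the point \<open>x\<close> iff
  \<open>b < x\<close>, and two points are related iff the same chords of \<open>Q\<close> pass over them.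
\<close>

definition point_equiv :: "'a::linorder set set \<Rightarrow> 'a \<Rightarrow> 'a \<Rightarrow> bool" where
  "point_equiv Q x y \<longleftrightarrow>
     (\<forall>b d. same_block Q b d \<longrightarrow> ((b < x \<longleftrightarrow> b < y) \<longleftrightarrow> (d < x \<longleftrightarrow> d < y)))"

text \<open>
  No chord of \<open>P\<close>, drawn between points, crosses a chord of \<open>Q\<close>, drawn between gaps.
\<close>

definition aligned :: "'a::linorder set set \<Rightarrow> 'a set set \<Rightarrow> bool" where
  "aligned P Q \<longleftrightarrow> (\<forall>b d. same_block Q b d \<longrightarrow> gap_equiv P b d)"

lemma aligned_iff_point_equiv:
  "aligned P Q \<longleftrightarrow> (\<forall>a c. same_block P a c \<longrightarrow> point_equiv Q a c)"
  unfolding aligned_def gap_equiv_def point_equiv_def by blast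

lemma gap_equiv_refl: "gap_equiv P x x"
  by (simp add: gap_equiv_def)

lemma gap_equiv_sym: "gap_equiv P x y \<Longrightarrow> gap_equiv P y x"
  by (simp add: gap_equiv_def)

lemma gap_equiv_trans: "gap_equiv P x y \<Longrightarrow> gap_equiv P y z \<Longrightarrow> gap_equiv P x z"
  by (simp add: gap_equiv_def)

text \<open>
  For \<open>x \<le> y\<close>, the chords that distinguish the two gaps are those with exactly one end in \<open>{x<..y}\<close>;
  the gaps are related iff no chord leaves this interval.
\<close>

lemma gap_equiv_leI:
  assumes "x \<le> y"
    and "\<And>a c. same_block P a c \<Longrightarrow> x < a \<Longrightarrow> a \<le> y \<Longrightarrow> x < c \<and> c \<le> y"
  shows "gap_equiv P x y"
  unfolding gap_equiv_def
proof (intro allI impI)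
  fix a c assume ac: "same_block P a c"
  show "(x < a \<longleftrightarrow> x < c) \<longleftrightarrow> (y < a \<longleftrightarrow> y < c)"
  proof -
    have "(x < a \<and> \<not> y < a) \<longleftrightarrow> (x < c \<and> \<not> y < c)"
      using assms(2)[OF ac] assms(2)[OF same_block_sym[OF ac]] unfolding not_less by blast
    moreover have "y < a \<Longrightarrow> x < a" "y < c \<Longrightarrow> x < c" using assms(1) by simp_all
    ultimately show ?thesis by argo
  qed
qed

lemma gap_equiv_leD:
  assumes "gap_equiv P x y" "same_block P a c" "x < a" "a \<le> y"
  shows "x < c \<and> c \<le> y"
proof -
  have "(x < a \<longleftrightarrow> x < c) \<longleftrightarrow> (y < a \<longleftrightarrow> y < c)"
    using assms(1,2) unfolding gap_equiv_def by blast
  then show ?thesis using assms(3,4) by (auto simp flip: not_less)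
qed

lemma alignedI:
  assumes "\<And>a b c d. same_block P a c \<Longrightarrow> same_block Q b d \<Longrightarrow> a < c \<Longrightarrow> b < d \<Longrightarrow>
             \<not> (b < a \<and> a \<le> d \<and> d < c) \<and> \<not> (a \<le> b \<and> b < c \<and> c \<le> d)"
  shows "aligned P Q"
proof -
  have le: "gap_equiv P b d" if bd: "same_block Q b d" "b < d" for b d
  proof (rule gap_equiv_leI)
    show "b \<le> d" using bd by simp
    fix a c assume ac: "same_block P a c" and a: "b < a" "a \<le> d"
    have "\<not> (a < c \<and> d < c)" "\<not> (c < a \<and> c \<le> b)"
      using assms[OF ac bd(1) _ bd(2)] assms[OF same_block_sym[OF ac] bd(1) _ bd(2)] a by auto
    then show "b < c \<and> c \<le> d" using a by (meson le_less_trans linorder_not_less)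
  qed
  show ?thesis
    unfolding aligned_def
  proof (intro allI impI)
    fix b d assume "same_block Q b d"
    then show "gap_equiv P b d"
      using le[of b d] le[of d b] same_block_sym[of Q b d] gap_equiv_refl gap_equiv_sym
      by (cases b d rule: linorder_cases) auto
  qed
qed

text \<open>
  If no chord leaves \<open>{a<..c}\<close> or \<open>{b<..d}\<close>, then none leaves their intersection \<open>{b<..c}\<close>. This is
  why every partition of the gaps by \<open>gap_equiv\<close> is noncrossing.
\<close>

lemma gap_equiv_noncrossing:
  assumes "a < b" "b < c" "c < d" "gap_equiv P a c" "gap_equiv P b d"
  shows "gap_equiv P a b"
proof -
  have "gap_equiv P b c"
  proof (rule gap_equiv_leI)
    fix e f assume ef: "same_block P e f" "b < e" "e \<le> c"
    show "b < f \<and> f \<le> c"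
      using gap_equiv_leD[OF assms(4) ef(1)] gap_equiv_leD[OF assms(5) ef(1)] ef assms(1-3)
      by auto
  qed (use assms in auto)
  then show ?thesis using assms(4) gap_equiv_sym gap_equiv_trans by blast
qed

section \<open>Recovering a partition from its complement\<close>

text \<open>
  The next three lemmas are one fact, read on a circle: let \<open>z\<close> precede \<open>w\<close> cyclically in a block of
  \<open>P\<close>, and let \<open>u\<close> precede \<open>w\<close> cyclically in the surrounding block of \<open>N\<close>. Then the gaps after \<open>z\<close> and
  after \<open>u\<close> are related. Indeed, the elements of the block of \<open>N\<close> from \<open>z\<close> to \<open>u\<close>, without \<open>z\<close> itself,
  are closed under \<open>P\<close> since a chord leaving them would cross \<open>z\<close>, \<open>w\<close>; and a chord of another
  block of \<open>N\<close> cannot separate \<open>z\<close> from \<open>u\<close>. The three cases are \<open>z < w\<close>; \<open>w\<close> the least and \<open>z\<close> the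
  greatest element of the block of \<open>P\<close>, with \<open>u < w\<close>; and the case where \<open>w\<close> is also the least
  element of the block of \<open>N\<close>, so that \<open>u\<close> is its greatest.
\<close>

locale noncrossing_pair =
  fixes X :: "'a::linorder set" and P N :: "'a set set"
  assumes fin: "finite X"
    and part_P: "partition_on X P" and nc_P: "noncrossing P"
    and part_N: "partition_on X N" and nc_N: "noncrossing N"
    and le: "\<And>a b. same_block P a b \<Longrightarrow> same_block N a b"
begin

lemmas P_sym = same_block_sym[of P]
lemmas P_trans = same_block_trans[OF part_P]
lemmas N_sym = same_block_sym[of N]
lemmas N_trans = same_block_trans[OF part_N]
lemmas P_cross = noncrossingD[OF nc_P part_P]
lemmas N_cross = noncrossingD[OF nc_N part_N]

lemma gap_equiv_after:
  assumes "z < w" "same_block P z w" and z: "\<And>v. same_block P z v \<Longrightarrow> v \<le> z \<or> w \<le> v"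
    and "z \<le> u" "u < w" "same_block N z u" and u: "\<And>v. same_block N z v \<Longrightarrow> v \<le> u \<or> w \<le> v"
  shows "gap_equiv P z u"
proof (rule gap_equiv_leI)
  fix a c assume ac: "same_block P a c" and a: "z < a" "a \<le> u"
  have aw: "a < w" using a(2) assms(5) by (rule le_less_trans)
  have not_za: "\<not> same_block P z a" using z[of a] a aw by auto
  have not_zc: "\<not> same_block P z c" using not_za ac P_sym P_trans by blast
  have nz: "c \<noteq> z" using not_za P_sym[OF ac] by auto
  have nw: "c \<noteq> w" using not_zc assms(2) by auto
  have left: "\<not> c < z"
  proof
    assume "c < z"
    then have "same_block P c z"
      using P_cross[of c z a w] a aw assms(2) P_sym[OF ac] by simp
    then show False using not_zc P_sym by blast
  qed
  show "z < c \<and> c \<le> u"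
  proof (cases "same_block N z a")
    case True
    then have "same_block N z c" using le[OF ac] N_trans by blast
    then have "c \<le> u \<or> w < c" using u[of c] nw by auto
    moreover have "\<not> w < c"
      using P_cross[of z a w c] a aw assms(2) ac not_za by auto
    ultimately show ?thesis using left nz by auto
  next
    case False
    then have "a \<noteq> u" using assms(6) by auto
    then have "a < u" using a(2) by simp
    have "\<not> u < c"
      using N_cross[of z a u c] a \<open>a < u\<close> assms(6) le[OF ac] False by auto
    then show ?thesis using left nz by auto
  qed
qed (use assms in auto)

lemma gap_equiv_before:
  assumes "w \<le> z" "same_block P w z" and w: "\<And>v. same_block P w v \<Longrightarrow> w \<le> v \<and> v \<le> z"
    and "u < w" "same_block N u w" and u: "\<And>v. same_block N w v \<Longrightarrow> v \<le> u \<or> w \<le> v"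
  shows "gap_equiv P u z"
proof (rule gap_equiv_leI)
  fix a c assume ac: "same_block P a c" and a: "u < a" "a \<le> z"
  have zu: "same_block N u z" using assms(5) le[OF assms(2)] N_trans by blast
  show "u < c \<and> c \<le> z"
  proof (cases "same_block P w a")
    case True
    then have "same_block P w c" using ac P_trans by blast
    then show ?thesis using w[of c] assms(4) by auto
  next
    case not_wa: False
    have "a \<noteq> z" using not_wa assms(2) by auto
    then have nz: "a < z" using a(2) by simp
    have nc: "\<not> same_block P w c" using not_wa ac P_sym P_trans by blast
    then have cz: "c \<noteq> z" using assms(2) by auto
    show ?thesis
    proof (cases "same_block N w a")
      case True
      then have "w \<le> a" using u[of a] a by auto
      moreover have "a \<noteq> w" using not_wa assms(2) P_sym P_trans by blast
      ultimately have "w < a" by simp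
      have "\<not> c < w"
      proof
        assume "c < w"
        then have "same_block P c w"
          using P_cross[of c w a z] \<open>w < a\<close> a nz assms(2) P_sym[OF ac] by simp
        then show False using nc P_sym by blast
      qed
      moreover have "\<not> z < c"
        using P_cross[of w a z c] \<open>w < a\<close> a nz assms(2) ac not_wa by auto
      ultimately show ?thesis using assms(4) by auto
    next
      case False
      then have not_ua: "\<not> same_block N u a" using assms(5) N_sym N_trans by blast
      have not_uc: "\<not> same_block N u c" using not_ua le[OF ac] N_sym N_trans by blast
      then have "c \<noteq> u" using le[OF ac] N_trans N_sym zu by blast
      moreover have "\<not> c < u"
      proof
        assume "c < u"
        then have "same_block N c u"
          using N_cross[of c u a z] a nz zu N_sym[OF le[OF ac]] by simp
        then show False using not_uc N_sym by blast
      qed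
      moreover have "\<not> z < c"
        using N_cross[of u a z c] a nz zu le[OF ac] not_ua by auto
      ultimately show ?thesis by auto
    qed
  qed
qed (use less_le_trans[OF assms(4,1)] in simp)

lemma gap_equiv_max:
  assumes "z \<le> u" "same_block P w z" and z: "\<And>v. same_block P w v \<Longrightarrow> v \<le> z"
    and "same_block N w u" and u: "\<And>v. same_block N w v \<Longrightarrow> w \<le> v \<and> v \<le> u"
  shows "gap_equiv P z u"
proof (rule gap_equiv_leI)
  fix a c assume ac: "same_block P a c" and a: "z < a" "a \<le> u"
  have zu: "same_block N z u" using assms(4) le[OF assms(2)] N_sym N_trans by blast
  have "w \<le> z" using u[OF le[OF assms(2)]] by simp
  have not_wa: "\<not> same_block P w a" using z[of a] a by auto
  have not_wc: "\<not> same_block P w c" using not_wa ac P_sym P_trans by blast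
  have nz: "c \<noteq> z" using not_wc assms(2) by auto
  show "z < c \<and> c \<le> u"
  proof (cases "same_block N w a")
    case True
    then have c: "same_block N w c" using le[OF ac] N_trans by blast
    have "c \<noteq> w" using not_wc assms(2) P_sym P_trans by blast
    then have "w < c" using u[OF c] by auto
    moreover have "\<not> (w < c \<and> c < z)"
      using P_cross[of w c z a] a assms(2) P_sym[OF ac] not_wc by auto
    ultimately show ?thesis using u[OF c] nz by auto
  next
    case False
    then have not_za: "\<not> same_block N z a" using le[OF assms(2)] N_trans by blast
    then have "a \<noteq> u" using zu by auto
    then have "a < u" using a(2) by simp
    have not_zc: "\<not> same_block N z c" using not_za le[OF ac] N_sym N_trans by blast
    have "\<not> c < z"
    proof
      assume "c < z"
      then have "same_block N c z"
        using N_cross[of c z a u] a \<open>a < u\<close> zu N_sym[OF le[OF ac]] by simp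
      then show False using not_zc N_sym by blast
    qed
    moreover have "\<not> u < c"
      using N_cross[of z a u c] a \<open>a < u\<close> zu le[OF ac] not_za by auto
    ultimately show ?thesis using nz by auto
  qed
qed (use assms in auto)

lemma finite_P_block: "finite {v. same_block P x v \<and> R v}"
  by (rule finite_subset[OF _ fin]) (use same_block_in[OF part_P] in blast)

lemma finite_N_block: "finite {v. same_block N x v \<and> R v}"
  by (rule finite_subset[OF _ fin]) (use same_block_in[OF part_N] in blast)

lemmas finite_whole_P_block = finite_P_block[of _ "\<lambda>_. True", simplified]
lemmas finite_whole_N_block = finite_N_block[of _ "\<lambda>_. True", simplified]

text \<open>
  Suppose that \<open>x < y\<close> are in one block of \<open>N\<close> but not of \<open>P\<close>. A chord of \<open>Q\<close> that passes over only
  one of them starts at the gap after \<open>z\<close>, the last element before \<open>y\<close> of the block of \<open>P\<close> of \<open>x\<close>: its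
  other end is the gap after \<open>u\<close>, the element of the block of \<open>N\<close> that cyclically precedes the
  successor \<open>w\<close> of \<open>z\<close> in the block of \<open>P\<close>.
\<close>

lemma same_block_recover_less:
  assumes Q: "\<And>x y. same_block Q x y \<longleftrightarrow> same_block N x y \<and> gap_equiv P x y"
    and "x < y" and N: "same_block N x y" and eq: "point_equiv Q x y"
  shows "same_block P x y"
proof (rule ccontr)
  assume not_P: "\<not> same_block P x y"
  have "x \<in> X" using N same_block_in[OF part_N] by blast
  then have refl: "same_block P x x" using same_block_refl_iff[OF part_P] by blast
  have separates: "\<not> same_block Q u v" if "u < x \<longleftrightarrow> u < y" "v < x \<longleftrightarrow> \<not> v < y" for u v
    using eq that unfolding point_equiv_def by blast
  \<comment> \<open>The gap after \<open>z\<close> lies between \<open>x\<close> and \<open>y\<close>; the gap \<open>u\<close> found below does not.\<close>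
  define z where "z = Max {v. same_block P x v \<and> v < y}"
  have "{v. same_block P x v \<and> v < y} \<noteq> {}" using refl \<open>x < y\<close> by blast
  from Max_in[OF finite_P_block this] have z: "same_block P x z" "z < y" by (auto simp: z_def)
  have z_max: "v \<le> z" if "same_block P x v" "v < y" for v
    using Max_ge[OF finite_P_block, of v] that by (simp add: z_def)
  have "x \<le> z" using z_max refl \<open>x < y\<close> by blast
  note zx = P_sym[OF z(1)]
  have P_z: "same_block P z v \<Longrightarrow> same_block P x v" for v using z(1) P_trans by blast
  have N_z: "same_block N z v \<longleftrightarrow> same_block N x v" for v
    using le[OF z(1)] N_sym N_trans by blast
  show False
  proof (cases "\<exists>w. same_block P x w \<and> y < w")
    case True
    define w where "w = Min {v. same_block P x v \<and> y < v}"
    have "{v. same_block P x v \<and> y < v} \<noteq> {}" using True by blast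
    from Min_in[OF finite_P_block this] have w: "same_block P x w" "y < w" by (auto simp: w_def)
    have w_min: "w \<le> v" if "same_block P x v" "y < v" for v
      using Min_le[OF finite_P_block, of v] that by (simp add: w_def)
    define u where "u = Max {v. same_block N x v \<and> v < w}"
    have "{v. same_block N x v \<and> v < w} \<noteq> {}" using N w by blast
    from Max_in[OF finite_N_block this] have u: "same_block N x u" "u < w" by (auto simp: u_def)
    have u_max: "v \<le> u" if "same_block N x v" "v < w" for v
      using Max_ge[OF finite_N_block, of v] that by (simp add: u_def)
    have "y \<le> u" using u_max N w by blast
    then have "\<not> u < y" "\<not> u < x" using \<open>x < y\<close> by auto
    then have not_Q: "\<not> same_block Q u z"
      using separates[of u z] \<open>x \<le> z\<close> z(2) by auto
    have "gap_equiv P z u"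
    proof (rule gap_equiv_after)
      show "z < w" "z \<le> u" using z w \<open>y \<le> u\<close> by auto
      show "same_block P z w" using zx w P_trans by blast
      show "v \<le> z \<or> w \<le> v" if "same_block P z v" for v
        using z_max[OF P_z[OF that]] w_min[OF P_z[OF that]] not_P P_z[OF that]
        by (cases v y rule: linorder_cases) auto
      show "v \<le> u \<or> w \<le> v" if "same_block N z v" for v
        using u_max[of v] that N_z by auto
    qed (use u N_z in auto)
    then have "same_block Q z u" using Q N_z u by blast
    then show False using not_Q same_block_sym[of Q z u] by simp
  next
    case no_above: False
    then have top: "v \<le> z" if "same_block P x v" for v
      using z_max that not_P by (metis linorder_less_linear)
    define w where "w = Min {v. same_block P x v}"
    have "{v. same_block P x v} \<noteq> {}" using refl by blast
    from Min_in[OF finite_whole_P_block this] have w: "same_block P x w" by (auto simp: w_def)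
    have w_min: "w \<le> v" if "same_block P x v" for v
      using Min_le[OF finite_whole_P_block, of v] that by (simp add: w_def)
    have wz: "same_block P w z" using w z P_sym P_trans by blast
    have P_w: "same_block P w v \<Longrightarrow> same_block P x v" for v using w P_trans by blast
    have N_w: "same_block N w v \<longleftrightarrow> same_block N x v" for v
      using le[OF w] N_sym N_trans by blast
    have "w \<le> x" using w_min refl by blast
    show False
    proof (cases "\<exists>u. same_block N x u \<and> u < w")
      case True
      define u where "u = Max {v. same_block N x v \<and> v < w}"
      have "{v. same_block N x v \<and> v < w} \<noteq> {}" using True by blast
      from Max_in[OF finite_N_block this] have u: "same_block N x u" "u < w" by (auto simp: u_def)
      have u_max: "v \<le> u" if "same_block N x v" "v < w" for v
        using Max_ge[OF finite_N_block, of v] that by (simp add: u_def)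
      have uw: "same_block N u w" using u N_w N_sym by blast
      have "gap_equiv P u z"
      proof (rule gap_equiv_before[OF _ wz _ u(2) uw])
        show "w \<le> z" using w_min z by blast
        show "w \<le> v \<and> v \<le> z" if "same_block P w v" for v
          using w_min top P_w[OF that] by blast
        show "v \<le> u \<or> w \<le> v" if "same_block N w v" for v
          using u_max[of v] that N_w by auto
      qed
      then have "same_block Q u z" using Q N_z u(1) N_sym by blast
      moreover have "u < x" using u(2) \<open>w \<le> x\<close> by (rule less_le_trans)
      moreover have "u < y" using \<open>u < x\<close> \<open>x < y\<close> by (rule less_trans)
      ultimately show False using separates[of u z] \<open>x \<le> z\<close> z(2) by auto
    next
      case no_below: False
      define u where "u = Max {v. same_block N x v}"
      have "{v. same_block N x v} \<noteq> {}" using N by blast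
      from Max_in[OF finite_whole_N_block this] have u: "same_block N x u" by (auto simp: u_def)
      have u_max: "v \<le> u" if "same_block N x v" for v
        using Max_ge[OF finite_whole_N_block, of v] that by (simp add: u_def)
      have "y \<le> u" using u_max N by blast
      then have "\<not> u < y" "\<not> u < x" using \<open>x < y\<close> by auto
      then have not_Q: "\<not> same_block Q u z"
        using separates[of u z] \<open>x \<le> z\<close> z(2) by auto
      have "gap_equiv P z u"
      proof (rule gap_equiv_max[OF _ wz])
        show "z \<le> u" using z \<open>y \<le> u\<close> by simp
        show "v \<le> z" if "same_block P w v" for v using top P_w[OF that] by blast
        show "same_block N w u" using u N_w by blast
        show "w \<le> v \<and> v \<le> u" if "same_block N w v" for v
          using that N_w u_max no_below by (meson linorder_not_less)
      qed
      then have "same_block Q z u" using Q N_z u by blast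
      then show False using not_Q same_block_sym[of Q z u] by simp
    qed
  qed
qed

text \<open>
  One direction only says that chords of \<open>P\<close> and of \<open>Q\<close> do not cross.
\<close>

lemma same_block_recover:
  assumes Q: "\<And>x y. same_block Q x y \<longleftrightarrow> same_block N x y \<and> gap_equiv P x y"
  shows "same_block P x y \<longleftrightarrow> same_block N x y \<and> point_equiv Q x y"
proof
  assume xy: "same_block P x y"
  have "aligned P Q" using Q unfolding aligned_def by blast
  then show "same_block N x y \<and> point_equiv Q x y"
    using xy le unfolding aligned_iff_point_equiv by blast
next
  assume *: "same_block N x y \<and> point_equiv Q x y"
  then have "point_equiv Q y x" unfolding point_equiv_def by blast
  with * show "same_block P x y"
    using same_block_recover_less[OF Q, of x y] same_block_recover_less[OF Q, of y x] N_sym P_sym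
      same_block_refl_iff[OF part_P] same_block_in[OF part_N]
    by (metis linorder_less_linear)
qed

end

section \<open>Shuffles\<close>

text \<open>
  The place in \<open>[kn]\<close> of the element \<open>x\<close> of the partition with index \<open>i\<close> of a shuffle of \<open>k\<close>. These
  places are ordered lexicographically, first by \<open>x\<close> and then by \<open>i\<close>, and they are congruent to
  \<open>i + 1\<close> modulo \<open>k\<close>.
\<close>

definition pos :: "nat \<Rightarrow> nat \<Rightarrow> nat \<Rightarrow> nat" where
  "pos k i x = k * x - (k - Suc i)"

lemma pos_eq:
  assumes "1 \<le> x" "i < k"
  shows "pos k i x = k * (x - 1) + i + 1"
proof -
  obtain y where y: "x = Suc y" using assms(1) by (cases x) auto
  show ?thesis using assms(2) unfolding pos_def y by simp
qed

lemma pos_less_iff: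
  assumes "1 \<le> x" "i < k" "1 \<le> y" "j < k"
  shows "pos k i x < pos k j y \<longleftrightarrow> x < y \<or> x = y \<and> i < j"
proof -
  have less: "pos k i x < pos k j y" if "1 \<le> x" "i < k" "1 \<le> y" "j < k" "x < y" for i j x y
  proof -
    have "k * (x - 1) + k = k * x" using that(1) by (cases x) auto
    also have "\<dots> \<le> k * (y - 1)" using that by simp
    finally show ?thesis using that by (simp add: pos_eq)
  qed
  show ?thesis
    using less[of x i y j] less[of y j x i] assms
    by (cases x y rule: linorder_cases) (auto simp: pos_eq)
qed

lemma pos_eq_iff:
  assumes "1 \<le> x" "i < k" "1 \<le> y" "j < k"
  shows "pos k i x = pos k j y \<longleftrightarrow> x = y \<and> i = j"
  using pos_less_iff[OF assms] pos_less_iff[OF assms(3,4,1,2)] by (auto simp: linorder_neq_iff)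

lemma pos_mod: "1 \<le> x \<Longrightarrow> i < k \<Longrightarrow> pos k i x mod k = Suc i mod k"
  by (simp add: pos_eq mod_Suc_eq)

lemma pos_range:
  assumes "1 \<le> x" "x \<le> n" "i < k"
  shows "1 \<le> pos k i x" "pos k i x \<le> k * n"
proof -
  show "1 \<le> pos k i x" using assms by (simp add: pos_eq)
  have "pos k i x \<le> k * x" by (simp add: pos_def)
  also have "\<dots> \<le> k * n" using assms by simp
  finally show "pos k i x \<le> k * n" .
qed

lemma pos_cases:
  assumes "1 \<le> u" "u \<le> k * n"
  obtains i x where "i < k" "1 \<le> x" "x \<le> n" "u = pos k i x"
proof
  have k: "0 < k" using assms by (cases k) auto
  show "(u - 1) mod k < k" using k by simp
  show x: "1 \<le> (u - 1) div k + 1" by simp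
  have "(u - 1) div k < n" using assms k by (simp add: less_mult_imp_div_less mult.commute)
  then show "(u - 1) div k + 1 \<le> n" by simp
  show "u = pos k ((u - 1) mod k) ((u - 1) div k + 1)"
    using assms(1) k by (simp add: pos_eq)
qed

lemma same_block_shuffle_parts:
  "same_block (shuffle_parts Qs) u v \<longleftrightarrow>
     (\<exists>i<length Qs. \<exists>x y. u = pos (length Qs) i x \<and> v = pos (length Qs) i y \<and> same_block (Qs ! i) x y)"
  unfolding shuffle_parts_def same_block_def map_blocks_def Let_def pos_def by fastforce

context
  fixes n :: nat and Qs :: "nat set set list"
  assumes parts: "\<And>i. i < length Qs \<Longrightarrow> partition_on {1..n} (Qs ! i)"
begin

lemma same_block_shuffle_pos:
  assumes "i < length Qs" "j < length Qs" "1 \<le> x" "1 \<le> y"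
  shows "same_block (shuffle_parts Qs) (pos (length Qs) i x) (pos (length Qs) j y) \<longleftrightarrow>
           i = j \<and> same_block (Qs ! i) x y"
proof
  assume "same_block (shuffle_parts Qs) (pos (length Qs) i x) (pos (length Qs) j y)"
  then obtain l x' y' where l: "l < length Qs" "same_block (Qs ! l) x' y'"
    and e: "pos (length Qs) i x = pos (length Qs) l x'" "pos (length Qs) j y = pos (length Qs) l y'"
    unfolding same_block_shuffle_parts by blast
  have "1 \<le> x'" "1 \<le> y'" using same_block_in[OF parts[OF l(1)] l(2)] by auto
  then show "i = j \<and> same_block (Qs ! i) x y"
    using e l assms by (auto simp: pos_eq_iff)
next
  assume "i = j \<and> same_block (Qs ! i) x y"
  then show "same_block (shuffle_parts Qs) (pos (length Qs) i x) (pos (length Qs) j y)"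
    unfolding same_block_shuffle_parts using assms by blast
qed

lemma same_block_shuffleE:
  assumes "same_block (shuffle_parts Qs) u v"
  obtains i x y where "i < length Qs" "1 \<le> x" "x \<le> n" "1 \<le> y" "y \<le> n" "same_block (Qs ! i) x y"
    "u = pos (length Qs) i x" "v = pos (length Qs) i y"
proof -
  obtain i x y where "i < length Qs" "same_block (Qs ! i) x y"
    "u = pos (length Qs) i x" "v = pos (length Qs) i y"
    using assms unfolding same_block_shuffle_parts by blast
  then show thesis using that same_block_in[OF parts] by auto
qed

lemma partition_on_shuffle_parts: "partition_on {1..length Qs * n} (shuffle_parts Qs)"
proof -
  define k where "k = length Qs"
  let ?S = "\<Union>i<k. (`) (pos k i) ` (Qs ! i)"
  have S: "shuffle_parts Qs = ?S"
    unfolding shuffle_parts_def Let_def map_blocks_def k_def pos_def by simp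
  have range: "1 \<le> x \<and> x \<le> n" if "B \<in> Qs ! i" "x \<in> B" "i < k" for B i x
    using that parts[of i] unfolding k_def partition_on_def by auto
  show ?thesis
    unfolding S k_def[symmetric]
  proof (rule partition_onI)
    show "\<Union>?S = {1..k * n}"
    proof (rule set_eqI, rule iffI)
      fix u assume "u \<in> \<Union>?S"
      then obtain i B x where "i < k" "B \<in> Qs ! i" "x \<in> B" "u = pos k i x" by auto
      then show "u \<in> {1..k * n}" using range pos_range[of x n i k] by auto
    next
      fix u assume "u \<in> {1..k * n}"
      then obtain i x where u: "i < k" "1 \<le> x" "x \<le> n" "u = pos k i x" using pos_cases[of u k n] by auto
      then have "x \<in> \<Union>(Qs ! i)" using parts[of i] unfolding k_def partition_on_def by auto
      then show "u \<in> \<Union>?S" using u by blast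
    qed
    show "{} \<notin> ?S" using partition_onD3[OF parts] unfolding k_def by auto
    fix p q assume p: "p \<in> ?S" and q: "q \<in> ?S" and "p \<noteq> q"
    show "disjnt p q"
    proof (rule ccontr)
      assume "\<not> disjnt p q"
      then obtain u where u: "u \<in> p" "u \<in> q" unfolding disjnt_def by blast
      obtain i B where i: "i < k" "B \<in> Qs ! i" "p = pos k i ` B" using p by auto
      obtain j C where j: "j < k" "C \<in> Qs ! j" "q = pos k j ` C" using q by auto
      obtain x y where xy: "x \<in> B" "y \<in> C" "pos k i x = pos k j y" using u i j by auto
      then have "x = y" "i = j"
        using pos_eq_iff[of x i k y j] range[OF i(2) xy(1) i(1)] range[OF j(2) xy(2) j(1)] i j by auto
      then have "B = C"
        using parts[of i] i j xy unfolding k_def partition_on_def disjoint_def by blast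
      with i j \<open>i = j\<close> \<open>p \<noteq> q\<close> show False by blast
    qed
  qed
qed

text \<open>
  For \<open>i < j\<close>, the place of \<open>x\<close> with index \<open>j\<close> comes after the place of \<open>x\<close> and before the place of
  \<open>x + 1\<close> with index \<open>i\<close>. Thus \<open>Q\<^sub>i\<close> and \<open>Q\<^sub>j\<close> lie in the shuffle as partitions of points and of gaps,
  and \<open>aligned\<close> says that their chords do not cross.
\<close>

lemma noncrossing_shuffle_parts_iff:
  "noncrossing (shuffle_parts Qs) \<longleftrightarrow>
     (\<forall>i<length Qs. noncrossing (Qs ! i)) \<and>
     (\<forall>i j. i < j \<longrightarrow> j < length Qs \<longrightarrow> aligned (Qs ! i) (Qs ! j))"
    (is "_ \<longleftrightarrow> ?nc \<and> ?al")
proof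
  let ?k = "length Qs"
  assume nc: "noncrossing (shuffle_parts Qs)"
  have cross: "i = j \<and> same_block (Qs ! i) a b"
    if "i < ?k" "j < ?k" "same_block (Qs ! i) a c" "same_block (Qs ! j) b d"
      "pos ?k i a < pos ?k j b" "pos ?k j b < pos ?k i c" "pos ?k i c < pos ?k j d"
    for i j a b c d
  proof -
    have pos1: "1 \<le> a" "1 \<le> b" "1 \<le> c" "1 \<le> d"
      using same_block_in[OF parts[OF that(1)] that(3)] same_block_in[OF parts[OF that(2)] that(4)]
      by auto
    have "same_block (shuffle_parts Qs) (pos ?k i a) (pos ?k i c)"
      "same_block (shuffle_parts Qs) (pos ?k j b) (pos ?k j d)"
      using same_block_shuffle_pos that pos1 by simp_all
    then have "same_block (shuffle_parts Qs) (pos ?k i a) (pos ?k j b)"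
      by (rule noncrossingD[OF nc partition_on_shuffle_parts that(5-7)])
    then show ?thesis using same_block_shuffle_pos that(1,2) pos1(1,2) by blast
  qed
  have less: "pos ?k i x < pos ?k j y \<longleftrightarrow> x < y \<or> x = y \<and> i < j"
    if "i < ?k" "j < ?k" "x \<in> {1..n}" "y \<in> {1..n}" for i j x y
    using pos_less_iff that by simp
  have ?nc
  proof (intro allI impI)
    fix i assume i: "i < ?k"
    show "noncrossing (Qs ! i)"
      unfolding noncrossing_iff_same_block[OF parts[OF i]]
    proof (intro allI impI)
      fix a b c d
      assume "a < b" "b < c" "c < d" and ac: "same_block (Qs ! i) a c" and bd: "same_block (Qs ! i) b d"
      then show "same_block (Qs ! i) a b"
        using cross[OF i i ac bd] less[OF i i] same_block_in[OF parts[OF i] ac]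
          same_block_in[OF parts[OF i] bd] by simp
    qed
  qed
  moreover have ?al
  proof (intro allI impI)
    fix i j assume ij: "i < j" "j < ?k"
    then have i: "i < ?k" by simp
    show "aligned (Qs ! i) (Qs ! j)"
    proof (rule alignedI)
      fix a b c d
      assume ac: "same_block (Qs ! i) a c" and bd: "same_block (Qs ! j) b d"
      note mem = same_block_in[OF parts[OF i] ac] same_block_in[OF parts[OF ij(2)] bd]
      have "\<not> (b < a \<and> a \<le> d \<and> d < c)"
        using cross[OF ij(2) i bd ac] less[OF ij(2) i mem(3,1)] less[OF i ij(2) mem(1,4)]
          less[OF ij(2) i mem(4,2)] ij(1) by (auto simp: le_less)
      moreover have "\<not> (a \<le> b \<and> b < c \<and> c \<le> d)"
        using cross[OF i ij(2) ac bd] less[OF i ij(2) mem(1,3)] less[OF ij(2) i mem(3,2)]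
          less[OF i ij(2) mem(2,4)] ij(1) by (auto simp: le_less)
      ultimately show "\<not> (b < a \<and> a \<le> d \<and> d < c) \<and> \<not> (a \<le> b \<and> b < c \<and> c \<le> d)" by simp
    qed
  qed
  ultimately show "?nc \<and> ?al" by simp
next
  let ?k = "length Qs"
  assume nc_al: "?nc \<and> ?al"
  show "noncrossing (shuffle_parts Qs)"
    unfolding noncrossing_iff_same_block[OF partition_on_shuffle_parts]
  proof (intro allI impI)
    fix u1 u2 u3 u4
    assume less: "u1 < u2" "u2 < u3" "u3 < u4" and "same_block (shuffle_parts Qs) u1 u3"
      and "same_block (shuffle_parts Qs) u2 u4"
    then obtain i a c j b d where i: "i < ?k" and j: "j < ?k"
      and ac: "same_block (Qs ! i) a c" and bd: "same_block (Qs ! j) b d"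
      and u: "u1 = pos ?k i a" "u3 = pos ?k i c" "u2 = pos ?k j b" "u4 = pos ?k j d"
      and ge: "1 \<le> a" "1 \<le> b" "1 \<le> c" "1 \<le> d"
      by (elim same_block_shuffleE) blast
    have ord: "a < b \<or> a = b \<and> i < j" "b < c \<or> b = c \<and> j < i" "c < d \<or> c = d \<and> i < j"
      using less pos_less_iff i j ge unfolding u by auto
    consider "i = j" | "i < j" | "j < i" by linarith
    then show "same_block (shuffle_parts Qs) u1 u2"
    proof cases
      case 1
      then have "same_block (Qs ! i) a b"
        using noncrossingD[of "Qs ! i" "{1..n}" a b c d] parts[OF i] nc_al i ord ac bd by auto
      then show ?thesis using same_block_shuffle_pos i j ge 1 unfolding u by simp
    next
      case 2
      then have "gap_equiv (Qs ! i) b d" using nc_al j bd unfolding aligned_def by blast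
      then have "(b < a \<longleftrightarrow> b < c) \<longleftrightarrow> (d < a \<longleftrightarrow> d < c)" using ac unfolding gap_equiv_def by blast
      with ord 2 have False by auto
      then show ?thesis ..
    next
      case 3
      then have "gap_equiv (Qs ! j) a c" using nc_al i ac unfolding aligned_def by blast
      then have "(a < b \<longleftrightarrow> a < d) \<longleftrightarrow> (c < b \<longleftrightarrow> c < d)" using bd unfolding gap_equiv_def by blast
      with ord 3 have False by auto
      then show ?thesis ..
    qed
  qed
qed

lemma shuffle_parts_in_NC_iff:
  "shuffle_parts Qs \<in> NC (length Qs * n) \<longleftrightarrow>
     (\<forall>i<length Qs. noncrossing (Qs ! i)) \<and>
     (\<forall>i j. i < j \<longrightarrow> j < length Qs \<longrightarrow> aligned (Qs ! i) (Qs ! j))"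
  using partition_on_shuffle_parts noncrossing_shuffle_parts_iff unfolding NC_def by simp

end

section \<open>Kreweras complements as groupings of gaps\<close>

text \<open>
  The union in the definition of compatibility is the shuffle of \<open>P\<close> and \<open>Q\<close>.
\<close>

lemma kreweras_compat_iff:
  assumes P: "P \<in> NC n"
  shows "kreweras_compat n P Q \<longleftrightarrow> partition_on {1..n} Q \<and> noncrossing Q \<and> aligned P Q"
proof (cases "partition_on {1..n} Q")
  case True
  have parts: "partition_on {1..n} ([P, Q] ! i)" if "i < length [P, Q]" for i
    using that P True unfolding NC_def by (cases i) auto
  have "map_blocks (\<lambda>x. 2 * x - 1) P \<union> map_blocks (\<lambda>x. 2 * x) Q = shuffle_parts [P, Q]"
    unfolding shuffle_parts_def by (simp add: lessThan_Suc Un_commute numeral_2_eq_2)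
  moreover have "shuffle_parts [P, Q] \<in> NC (length [P, Q] * n) \<longleftrightarrow> noncrossing Q \<and> aligned P Q"
  proof -
    have "shuffle_parts [P, Q] \<in> NC (length [P, Q] * n) \<longleftrightarrow>
        (\<forall>i<length [P, Q]. noncrossing ([P, Q] ! i)) \<and>
        (\<forall>i j. i < j \<longrightarrow> j < length [P, Q] \<longrightarrow> aligned ([P, Q] ! i) ([P, Q] ! j))"
      by (rule shuffle_parts_in_NC_iff) (rule parts)
    also have "\<dots> \<longleftrightarrow> noncrossing Q \<and> aligned P Q"
      using P by (auto simp: NC_def less_Suc_eq)
    finally show ?thesis .
  qed
  moreover have "length [P, Q] * n = 2 * n" by simp
  ultimately show ?thesis using True unfolding kreweras_compat_def by (simp only: simp_thms)
qed (simp add: kreweras_compat_def)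

text \<open>
  Compatibility with \<open>P\<close> means being noncrossing and relating only gaps that \<open>gap_equiv P\<close> relates. As
  \<open>gap_equiv P\<close> is itself a noncrossing equivalence relation, it is the coarsest choice.
\<close>

lemma kreweras_characterization:
  assumes P: "P \<in> NC n"
  shows "partition_on {1..n} (kreweras n P)"
    and "same_block (kreweras n P) x y \<longleftrightarrow> x \<in> {1..n} \<and> y \<in> {1..n} \<and> gap_equiv P x y"
proof -
  have "\<exists>Q. partition_on {1..n} Q \<and>
      (\<forall>x y. same_block Q x y \<longleftrightarrow> x \<in> {1..n} \<and> y \<in> {1..n} \<and> gap_equiv P x y)"
    by (rule partition_of_equivalence)
      (blast intro: gap_equiv_refl gap_equiv_sym gap_equiv_trans)+
  then obtain Q where Q: "partition_on {1..n} Q"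
    "\<And>x y. same_block Q x y \<longleftrightarrow> x \<in> {1..n} \<and> y \<in> {1..n} \<and> gap_equiv P x y"
    by blast
  have al: "aligned P Q" unfolding aligned_def using Q(2) by blast
  have "noncrossing Q"
    unfolding noncrossing_iff_same_block[OF Q(1)] using Q(2) gap_equiv_noncrossing by blast
  then have compat: "kreweras_compat n P Q" using kreweras_compat_iff[OF P] Q(1) al by blast
  have coarsest: "refines R Q" if "kreweras_compat n P R" for R
  proof -
    have R: "partition_on {1..n} R" "aligned P R" using that kreweras_compat_iff[OF P] by blast+
    show ?thesis
      unfolding refines_iff_same_block[OF R(1) Q(1)]
      using Q(2) R(2) same_block_in[OF R(1)] unfolding aligned_def by blast
  qed
  have "kreweras n P = Q"
    unfolding kreweras_def
  proof (rule the_equality)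
    show "kreweras_compat n P Q \<and> (\<forall>R. kreweras_compat n P R \<longrightarrow> refines R Q)"
      using compat coarsest by blast
    fix Q' assume Q': "kreweras_compat n P Q' \<and> (\<forall>R. kreweras_compat n P R \<longrightarrow> refines R Q')"
    then have part: "partition_on {1..n} Q'" using kreweras_compat_iff[OF P] by blast
    have "refines Q' Q" "refines Q Q'" using Q' compat coarsest by blast+
    then show "Q' = Q"
      unfolding refines_iff_same_block[OF part Q(1)] refines_iff_same_block[OF Q(1) part]
      by (intro partition_on_eqI[OF part Q(1)]) blast
  qed
  with Q show "partition_on {1..n} (kreweras n P)"
    "same_block (kreweras n P) x y \<longleftrightarrow> x \<in> {1..n} \<and> y \<in> {1..n} \<and> gap_equiv P x y" by simp_all
qed

lemma same_block_map_blocks: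
  "same_block (map_blocks f P) u v \<longleftrightarrow> (\<exists>x y. u = f x \<and> v = f y \<and> same_block P x y)"
  unfolding same_block_def map_blocks_def by fastforce

lemma partition_on_map_blocks:
  assumes "partition_on A P" "inj_on f A"
  shows "partition_on (f ` A) (map_blocks f P)"
proof -
  have "map_blocks f P = (`) f ` P - {{}}"
    unfolding map_blocks_def using partition_onD3[OF assms(1)] by auto
  then show ?thesis using partition_on_inj_image[OF assms] by simp
qed

text \<open>
  The relation \<open>gap_equiv\<close> depends only on the order, which \<open>rank X\<close> preserves.
\<close>

lemma kreweras_on_characterization:
  fixes X :: "'a::linorder set"
  assumes fin: "finite X" and part: "partition_on X P" and nc: "noncrossing P"
  shows "partition_on X (kreweras_on X P)"
    and "same_block (kreweras_on X P) x y \<longleftrightarrow> x \<in> X \<and> y \<in> X \<and> gap_equiv P x y"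
proof -
  let ?r = "rank X"
  let ?P = "map_blocks ?r P"
  let ?K = "kreweras (card X) ?P"
  have bij: "bij_betw ?r X {1..card X}" using fin by (rule bij_betw_rank)
  then have inj: "inj_on ?r X" and im: "?r ` X = {1..card X}" by (auto simp: bij_betw_def)
  have less: "?r a < ?r b \<longleftrightarrow> a < b" if "a \<in> X" "b \<in> X" for a b
    using strict_mono_on_less[OF strict_mono_on_rank[OF fin]] that by blast
  have same: "same_block ?P (?r a) (?r b) \<longleftrightarrow> same_block P a b" if "a \<in> X" "b \<in> X" for a b
  proof
    assume "same_block ?P (?r a) (?r b)"
    then obtain a' b' where *: "?r a = ?r a'" "?r b = ?r b'" "same_block P a' b'"
      unfolding same_block_map_blocks by blast
    then have "a' = a" "b' = b" using inj that same_block_in[OF part *(3)] by (auto dest: inj_onD)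
    with * show "same_block P a b" by simp
  qed (auto simp: same_block_map_blocks)
  have part_r: "partition_on {1..card X} ?P"
    using partition_on_map_blocks[OF part inj] im by simp
  have "noncrossing ?P"
    unfolding noncrossing_iff_same_block[OF part_r]
  proof (intro allI impI)
    fix a b c d
    assume lt: "a < b" "b < c" "c < d" and ac: "same_block ?P a c" and bd: "same_block ?P b d"
    obtain a' c' where 1: "a = ?r a'" "c = ?r c'" "same_block P a' c'"
      using ac unfolding same_block_map_blocks by blast
    obtain b' d' where 2: "b = ?r b'" "d = ?r d'" "same_block P b' d'"
      using bd unfolding same_block_map_blocks by blast
    note mem = same_block_in[OF part 1(3)] same_block_in[OF part 2(3)]
    have "a' < b'" "b' < c'" "c' < d'" using lt less mem 1 2 by auto
    then have "same_block P a' b'" by (rule noncrossingD[OF nc part _ _ _ 1(3) 2(3)])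
    then show "same_block ?P a b" using same mem 1 2 by simp
  qed
  with part_r have NC: "?P \<in> NC (card X)" by (simp add: NC_def)
  have gap: "gap_equiv ?P (?r x) (?r y) \<longleftrightarrow> gap_equiv P x y" if xy: "x \<in> X" "y \<in> X" for x y
  proof
    assume g: "gap_equiv ?P (?r x) (?r y)"
    show "gap_equiv P x y"
      unfolding gap_equiv_def
    proof (intro allI impI)
      fix a c assume ac: "same_block P a c"
      note mem = same_block_in[OF part ac]
      have "same_block ?P (?r a) (?r c)" using same mem ac by simp
      then have "(?r x < ?r a \<longleftrightarrow> ?r x < ?r c) \<longleftrightarrow> (?r y < ?r a \<longleftrightarrow> ?r y < ?r c)"
        using g unfolding gap_equiv_def by blast
      then show "(x < a \<longleftrightarrow> x < c) \<longleftrightarrow> (y < a \<longleftrightarrow> y < c)" using less mem xy by simp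
    qed
  next
    assume g: "gap_equiv P x y"
    show "gap_equiv ?P (?r x) (?r y)"
      unfolding gap_equiv_def
    proof (intro allI impI)
      fix a c assume "same_block ?P a c"
      then obtain a' c' where ac: "a = ?r a'" "c = ?r c'" "same_block P a' c'"
        unfolding same_block_map_blocks by blast
      note mem = same_block_in[OF part ac(3)]
      have "(x < a' \<longleftrightarrow> x < c') \<longleftrightarrow> (y < a' \<longleftrightarrow> y < c')"
        using g ac(3) unfolding gap_equiv_def by blast
      then show "(?r x < a \<longleftrightarrow> ?r x < c) \<longleftrightarrow> (?r y < a \<longleftrightarrow> ?r y < c)"
        using less mem xy unfolding ac by simp
    qed
  qed
  note K = kreweras_characterization[OF NC]
  have inv_inj: "inj_on (inv_into X ?r) {1..card X}" by (rule inj_on_inv_into) (simp add: im)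
  have inv_im: "inv_into X ?r ` {1..card X} = X"
    using bij_betw_inv_into[OF bij] by (simp add: bij_betw_def)
  show "partition_on X (kreweras_on X P)"
    unfolding kreweras_on_def using partition_on_map_blocks[OF K(1) inv_inj] inv_im by simp
  show "same_block (kreweras_on X P) x y \<longleftrightarrow> x \<in> X \<and> y \<in> X \<and> gap_equiv P x y"
  proof
    assume "same_block (kreweras_on X P) x y"
    then obtain u v where uv: "x = inv_into X ?r u" "y = inv_into X ?r v" "same_block ?K u v"
      unfolding kreweras_on_def same_block_map_blocks by blast
    have "u \<in> ?r ` X" "v \<in> ?r ` X" using uv(3) unfolding K(2) im by simp_all
    then have "x \<in> X" "y \<in> X" "?r x = u" "?r y = v"
      unfolding uv by (simp_all add: inv_into_into f_inv_into_f)
    then show "x \<in> X \<and> y \<in> X \<and> gap_equiv P x y"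
      using uv(3) gap[of x y] unfolding K(2) by simp
  next
    assume xy: "x \<in> X \<and> y \<in> X \<and> gap_equiv P x y"
    then have "?r x \<in> {1..card X}" "?r y \<in> {1..card X}" using im by blast+
    with xy have "same_block ?K (?r x) (?r y)" using gap[of x y] unfolding K(2) by simp
    moreover have "x = inv_into X ?r (?r x)" "y = inv_into X ?r (?r y)" using xy inj by simp_all
    ultimately show "same_block (kreweras_on X P) x y"
      unfolding kreweras_on_def same_block_map_blocks by blast
  qed
qed

lemma same_block_restrict_blocks:
  "same_block (restrict_blocks P Y) a b \<longleftrightarrow> same_block P a b \<and> a \<in> Y \<and> b \<in> Y"
  unfolding same_block_def restrict_blocks_def by auto

lemma partition_on_restrict_blocks:
  assumes "partition_on X P" "Y \<subseteq> X"
  shows "partition_on Y (restrict_blocks P Y)"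
proof -
  have "restrict_blocks P Y = (\<inter>) Y ` P - {{}}"
    unfolding restrict_blocks_def by (auto simp: Int_commute)
  moreover have "Y \<inter> X = Y" using assms(2) by blast
  ultimately show ?thesis using partition_on_restrict[OF assms(1), of Y] by simp
qed

lemma noncrossing_restrict_blocks:
  assumes "partition_on X P" "noncrossing P" "Y \<subseteq> X"
  shows "noncrossing (restrict_blocks P Y)"
  using noncrossing_iff_same_block[OF assms(1)] assms(2)
  unfolding noncrossing_iff_same_block[OF partition_on_restrict_blocks[OF assms(1,3)]]
    same_block_restrict_blocks by blast

text \<open>
  A chord of \<open>P\<close> in another block of \<open>N\<close> passes over both or none of \<open>x\<close> and \<open>y\<close>, for otherwise it would
  cross the chord \<open>x\<close>, \<open>y\<close> of \<open>N\<close>. So the chords inside \<open>Y\<close> decide.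
\<close>

lemma (in noncrossing_pair) gap_equiv_restrict_blocks:
  assumes xy: "same_block N x y" and Y: "Y \<in> N" "x \<in> Y" "y \<in> Y"
  shows "gap_equiv (restrict_blocks P Y) x y \<longleftrightarrow> gap_equiv P x y"
proof
  show "gap_equiv P x y \<Longrightarrow> gap_equiv (restrict_blocks P Y) x y"
    unfolding gap_equiv_def same_block_restrict_blocks by blast
next
  have le_case: "gap_equiv P x y"
    if xy: "x \<le> y" "same_block N x y" and Y: "x \<in> Y" "y \<in> Y"
      and g: "gap_equiv (restrict_blocks P Y) x y" for x y
  proof (rule gap_equiv_leI[OF xy(1)])
    fix a c assume ac: "same_block P a c" and a: "x < a" "a \<le> y"
    have Y_eq: "v \<in> Y \<longleftrightarrow> same_block N x v" for v
      using block_eq_Collect[OF part_N \<open>Y \<in> N\<close> Y(1)] by auto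
    show "x < c \<and> c \<le> y"
    proof (cases "same_block N x a")
      case True
      then have "same_block (restrict_blocks P Y) a c"
        using ac le[OF ac] N_trans Y_eq by (simp add: same_block_restrict_blocks)
      then show ?thesis by (rule gap_equiv_leD[OF g _ a])
    next
      case False
      have not_xc: "\<not> same_block N x c" using False le[OF ac] N_sym N_trans by blast
      have "a \<noteq> y" using False xy(2) by auto
      then have ay: "a < y" using a(2) by simp
      have "c \<noteq> x" using le[OF ac] False N_sym by blast
      moreover have "\<not> c < x"
      proof
        assume "c < x"
        then have "same_block N c x"
          by (rule N_cross[OF _ a(1) ay N_sym[OF le[OF ac]] xy(2)])
        then show False using not_xc N_sym by blast
      qed
      moreover have "\<not> y < c"
        using N_cross[OF a(1) ay _ xy(2) le[OF ac]] False by blast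
      ultimately show ?thesis by auto
    qed
  qed
  assume g: "gap_equiv (restrict_blocks P Y) x y"
  show "gap_equiv P x y"
  proof (cases "x \<le> y")
    case True
    then show ?thesis using le_case xy Y g by blast
  next
    case False
    then have "gap_equiv P y x"
      using le_case[of y x] N_sym[OF xy] Y gap_equiv_sym[OF g] by simp
    then show ?thesis by (rule gap_equiv_sym)
  qed
qed

lemma partition_on_UN_blocks:
  assumes N: "partition_on X N" and f: "\<And>Y. Y \<in> N \<Longrightarrow> partition_on Y (f Y)"
  shows "partition_on X (\<Union>Y\<in>N. f Y)"
proof (rule partition_onI)
  show "\<Union>(\<Union>Y\<in>N. f Y) = X"
  proof -
    have "\<Union>(\<Union>Y\<in>N. f Y) = (\<Union>Y\<in>N. \<Union>(f Y))" by blast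
    also have "\<dots> = (\<Union>Y\<in>N. Y)" using partition_onD1[OF f] by simp
    finally show ?thesis using partition_onD1[OF N] by simp
  qed
  show "{} \<notin> (\<Union>Y\<in>N. f Y)" using partition_onD3[OF f] by auto
  fix p q assume "p \<in> (\<Union>Y\<in>N. f Y)" "q \<in> (\<Union>Y\<in>N. f Y)" and ne: "p \<noteq> q"
  then obtain Y Z where Y: "Y \<in> N" "p \<in> f Y" and Z: "Z \<in> N" "q \<in> f Z" by blast
  show "disjnt p q"
  proof (cases "Y = Z")
    case True
    then show ?thesis
      using partition_onD2[OF f[OF Y(1)]] Y Z ne by (auto simp: pairwise_def)
  next
    case False
    then have "Y \<inter> Z = {}" using partition_onD2[OF N] Y Z by (auto simp: disjoint_def)
    moreover have "p \<subseteq> Y" "q \<subseteq> Z"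
      using partition_onD1[OF f[OF Y(1)]] partition_onD1[OF f[OF Z(1)]] Y Z by auto
    ultimately show ?thesis unfolding disjnt_def by blast
  qed
qed

text \<open>
  The relative complement is the meet of \<open>N\<close> with the complement of \<open>P\<close>.
\<close>

lemma kreweras_rel_characterization:
  assumes "noncrossing_pair X P N"
  shows "partition_on X (kreweras_rel N P)"
    and "same_block (kreweras_rel N P) x y \<longleftrightarrow> same_block N x y \<and> gap_equiv P x y"
proof -
  interpret noncrossing_pair X P N by fact
  have sub: "Y \<subseteq> X" if "Y \<in> N" for Y using partition_onD1[OF part_N] that by blast
  have Y: "finite Y" "partition_on Y (restrict_blocks P Y)" "noncrossing (restrict_blocks P Y)"
    if "Y \<in> N" for Y
    using finite_subset[OF sub[OF that] fin] partition_on_restrict_blocks[OF part_P sub[OF that]]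
      noncrossing_restrict_blocks[OF part_P nc_P sub[OF that]] by simp_all
  note on = kreweras_on_characterization[OF Y]
  show "partition_on X (kreweras_rel N P)"
    unfolding kreweras_rel_def by (rule partition_on_UN_blocks[OF part_N on(1)])
  have "same_block (kreweras_rel N P) x y \<longleftrightarrow>
      (\<exists>Y\<in>N. same_block (kreweras_on Y (restrict_blocks P Y)) x y)"
    unfolding kreweras_rel_def same_block_def by blast
  also have "\<dots> \<longleftrightarrow> (\<exists>Y\<in>N. x \<in> Y \<and> y \<in> Y \<and> gap_equiv (restrict_blocks P Y) x y)"
    using on(2) by blast
  also have "\<dots> \<longleftrightarrow> same_block N x y \<and> gap_equiv P x y"
    using gap_equiv_restrict_blocks unfolding same_block_def by blast
  finally show "same_block (kreweras_rel N P) x y \<longleftrightarrow> same_block N x y \<and> gap_equiv P x y" .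
qed

section \<open>Relative complementation is a bijection\<close>

lemma NC_D: "P \<in> NC n \<Longrightarrow> partition_on {1..n} P" "P \<in> NC n \<Longrightarrow> noncrossing P"
  by (simp_all add: NC_def)

lemma refines_NC_iff:
  "P \<in> NC n \<Longrightarrow> N \<in> NC n \<Longrightarrow> refines P N \<longleftrightarrow> (\<forall>a b. same_block P a b \<longrightarrow> same_block N a b)"
  by (rule refines_iff_same_block[OF NC_D(1) NC_D(1)])

lemma refines_transitive: "refines P Q \<Longrightarrow> refines Q R \<Longrightarrow> refines P R"
  unfolding refines_def by (meson order_trans)

lemma noncrossing_pairI:
  assumes "P \<in> NC n" "N \<in> NC n" "refines P N"
  shows "noncrossing_pair {1..n} P N"
  using assms refines_NC_iff[OF assms(1,2)] by unfold_locales (auto simp: NC_def)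

lemma finite_NC: "finite (NC n)"
proof (rule finite_subset)
  show "NC n \<subseteq> {P. partition_on {1..n} P}" by (auto simp: NC_def)
  show "finite {P. partition_on {1..n} P}" by (rule finitely_many_partition_on) simp
qed

context
  fixes n :: nat and P N :: "nat set set"
  assumes P: "P \<in> NC n" and N: "N \<in> NC n" and le: "refines P N"
begin

lemma same_block_kreweras_rel:
  "same_block (kreweras_rel N P) x y \<longleftrightarrow> same_block N x y \<and> gap_equiv P x y"
  by (rule kreweras_rel_characterization[OF noncrossing_pairI[OF P N le]])

lemma kreweras_rel_in_NC: "kreweras_rel N P \<in> NC n"
proof -
  have part: "partition_on {1..n} (kreweras_rel N P)"
    by (rule kreweras_rel_characterization[OF noncrossing_pairI[OF P N le]])
  have "noncrossing (kreweras_rel N P)"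
    unfolding noncrossing_iff_same_block[OF part] same_block_kreweras_rel
  proof (intro allI impI, elim conjE)
    fix a b c d
    assume lt: "a < b" "b < c" "c < d" and "same_block N a c" "gap_equiv P a c"
      "same_block N b d" "gap_equiv P b d"
    then show "same_block N a b \<and> gap_equiv P a b"
      using noncrossingD[OF NC_D(2,1)[OF N] lt] gap_equiv_noncrossing[OF lt] by simp
  qed
  with part show ?thesis by (simp add: NC_def)
qed

lemma kreweras_rel_refines: "refines (kreweras_rel N P) N"
  unfolding refines_NC_iff[OF kreweras_rel_in_NC N] same_block_kreweras_rel by simp

lemma same_block_iff_kreweras_rel:
  "same_block P x y \<longleftrightarrow> same_block N x y \<and> point_equiv (kreweras_rel N P) x y"
  by (rule noncrossing_pair.same_block_recover[OF noncrossing_pairI[OF P N le] same_block_kreweras_rel])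

end

lemma kreweras_rel_inj:
  assumes N: "N \<in> NC n" and P: "P \<in> NC n" "refines P N" and P': "P' \<in> NC n" "refines P' N"
    and eq: "kreweras_rel N P = kreweras_rel N P'"
  shows "P = P'"
  using same_block_iff_kreweras_rel[OF P(1) N P(2)] same_block_iff_kreweras_rel[OF P'(1) N P'(2)] eq
  by (intro partition_on_eqI[OF NC_D(1)[OF P(1)] NC_D(1)[OF P'(1)]]) simp

text \<open>
  Relative complementation is an injective map from the finite set of noncrossing partitions below
  \<open>N\<close> to itself.
\<close>

lemma kreweras_rel_surj:
  assumes N: "N \<in> NC n" and Q: "Q \<in> NC n" "refines Q N"
  obtains P where "P \<in> NC n" "refines P N" "kreweras_rel N P = Q"
proof -
  let ?I = "{P \<in> NC n. refines P N}"
  have "kreweras_rel N ` ?I = ?I"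
  proof (rule endo_inj_surj)
    show "finite ?I" using finite_NC by simp
    show "kreweras_rel N ` ?I \<subseteq> ?I"
      using kreweras_rel_in_NC[OF _ N] kreweras_rel_refines[OF _ N] by auto
    show "inj_on (kreweras_rel N) ?I"
      by (rule inj_onI) (use kreweras_rel_inj[OF N] in simp)
  qed
  with Q have "Q \<in> kreweras_rel N ` ?I" by simp
  then show thesis using that by blast
qed

text \<open>
  Complementation is complementation relative to the one-block partition, so the facts above apply
  to it.
\<close>

abbreviation top_part :: "nat \<Rightarrow> nat set set" where
  "top_part n \<equiv> {{1..n}}"

lemma same_block_top_part: "same_block (top_part n) x y \<longleftrightarrow> x \<in> {1..n} \<and> y \<in> {1..n}"
  by (simp add: same_block_def)

lemma top_part_in_NC: "1 \<le> n \<Longrightarrow> top_part n \<in> NC n"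
  by (simp add: NC_def noncrossing_def partition_on_space)

lemma refines_top_part: "P \<in> NC n \<Longrightarrow> refines P (top_part n)"
  using partition_onD1[OF NC_D(1)] unfolding refines_def by blast

lemma kreweras_eq_kreweras_rel:
  assumes "1 \<le> n" "P \<in> NC n"
  shows "kreweras n P = kreweras_rel (top_part n) P"
  using assms
  by (intro partition_on_eqI[OF kreweras_characterization(1) NC_D(1)])
    (simp_all only: kreweras_characterization(2) same_block_kreweras_rel kreweras_rel_in_NC
      refines_top_part top_part_in_NC same_block_top_part conj_assoc)

lemma bij_betw_kreweras:
  assumes "1 \<le> n"
  shows "bij_betw (kreweras n) (NC n) (NC n)"
proof -
  note top = top_part_in_NC[OF assms] and eq = kreweras_eq_kreweras_rel[OF assms]
  have "inj_on (kreweras n) (NC n)"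
    by (rule inj_onI) (metis eq kreweras_rel_inj[OF top] refines_top_part)
  moreover have "kreweras n ` NC n \<subseteq> NC n"
    using eq kreweras_rel_in_NC[OF _ top] refines_top_part by auto
  ultimately show ?thesis using endo_inj_surj[OF finite_NC] by (simp add: bij_betw_def)
qed

section \<open>Multichains and noncrossing shuffles\<close>

text \<open>
  The list of partitions that \<open>nabla\<close> shuffles.
\<close>

definition complements :: "nat \<Rightarrow> nat set set list \<Rightarrow> nat set set list" where
  "complements n Ps = map2 (\<lambda>P N. kreweras_rel N P) (butlast Ps) (tl Ps) @ [kreweras n (last Ps)]"

lemma length_complements: "Ps \<noteq> [] \<Longrightarrow> length (complements n Ps) = length Ps"
  by (simp add: complements_def Suc_diff_Suc)

lemma complements_nth:
  assumes n: "1 \<le> n" and Ps: "set Ps \<subseteq> NC n" and i: "i < length Ps"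
  shows "complements n Ps ! i = kreweras_rel ((Ps @ [top_part n]) ! Suc i) (Ps ! i)"
proof (cases "Suc i < length Ps")
  case True
  then have "i < length (map2 (\<lambda>P N. kreweras_rel N P) (butlast Ps) (tl Ps))" by simp
  then show ?thesis using True
    by (simp add: complements_def nth_append nth_butlast nth_tl)
next
  case False
  then have i_eq: "i = length Ps - 1" using i by simp
  have ne: "Ps \<noteq> []" using i by auto
  have "last Ps = Ps ! i" using ne i_eq by (simp add: last_conv_nth)
  moreover have "Ps ! i \<in> NC n" using Ps i by (meson nth_mem subsetD)
  moreover have "complements n Ps ! i = kreweras n (last Ps)"
    using i_eq by (simp add: complements_def nth_append)
  moreover have "(Ps @ [top_part n]) ! Suc i = top_part n"
  proof -
    have "Suc i = length Ps" using False i by simp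
    then show ?thesis by (simp add: nth_append)
  qed
  ultimately show ?thesis using kreweras_eq_kreweras_rel[OF n] by simp
qed

text \<open>
  With the one-block partition appended to the multichain, the list of complements consists of the
  relative complements of consecutive levels, without a special last entry.
\<close>

locale multichain =
  fixes n k :: nat and Ps :: "nat set set list"
  assumes n: "1 \<le> n" and k: "1 \<le> k" and Ps: "Ps \<in> multichains n k"
begin

definition level :: "nat \<Rightarrow> nat set set" where
  "level i = (Ps @ [top_part n]) ! i"

lemma length_Ps: "length Ps = k" and set_Ps: "set Ps \<subseteq> NC n"
  using Ps by (simp_all add: multichains_def)

lemma level_last: "level k = top_part n"
  by (simp add: level_def nth_append length_Ps)

lemma level_nth: "i < k \<Longrightarrow> level i = Ps ! i"
  by (simp add: level_def nth_append length_Ps)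

lemma level_in_NC: "i \<le> k \<Longrightarrow> level i \<in> NC n"
  using set_Ps top_part_in_NC[OF n] length_Ps
  by (cases "i = k") (auto simp: level_last level_nth)

lemma level_refines: "i < j \<Longrightarrow> j \<le> k \<Longrightarrow> refines (level i) (level j)"
proof (cases "j = k")
  case True
  then show "i < j \<Longrightarrow> j \<le> k \<Longrightarrow> refines (level i) (level j)"
    using refines_top_part level_in_NC by (simp add: level_last)
next
  case False
  then show "i < j \<Longrightarrow> j \<le> k \<Longrightarrow> refines (level i) (level j)"
    using Ps sorted_wrt_nth_less[of refines Ps i j]
    by (simp add: level_nth multichains_def)
qed

lemma same_block_level_mono:
  assumes "i \<le> j" "j \<le> k" "same_block (level i) a b"
  shows "same_block (level j) a b"
  using assms level_refines[of i j] refines_NC_iff[OF level_in_NC level_in_NC, of i j]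
  by (cases "i = j") auto

lemma length_complements_eq: "length (complements n Ps) = k"
  using length_complements[of Ps n] length_Ps k by force

lemma complements_level: "i < k \<Longrightarrow> complements n Ps ! i = kreweras_rel (level (Suc i)) (level i)"
  using complements_nth[OF n set_Ps] length_Ps by (simp add: level_def nth_append)

lemma
  assumes "i < k"
  shows complements_in_NC: "complements n Ps ! i \<in> NC n"
    and same_block_complements: "same_block (complements n Ps ! i) x y \<longleftrightarrow>
      same_block (level (Suc i)) x y \<and> gap_equiv (level i) x y"
    and same_block_level: "same_block (level i) x y \<longleftrightarrow>
      same_block (level (Suc i)) x y \<and> point_equiv (complements n Ps ! i) x y"
proof -
  have *: "level i \<in> NC n" "level (Suc i) \<in> NC n" "refines (level i) (level (Suc i))"
    using assms level_in_NC level_refines by simp_all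
  show "complements n Ps ! i \<in> NC n"
    "same_block (complements n Ps ! i) x y \<longleftrightarrow>
      same_block (level (Suc i)) x y \<and> gap_equiv (level i) x y"
    "same_block (level i) x y \<longleftrightarrow>
      same_block (level (Suc i)) x y \<and> point_equiv (complements n Ps ! i) x y"
    unfolding complements_level[OF assms]
    by (fact kreweras_rel_in_NC[OF *] same_block_kreweras_rel[OF *] same_block_iff_kreweras_rel[OF *])+
qed

lemma partition_on_complements:
  "i < length (complements n Ps) \<Longrightarrow> partition_on {1..n} (complements n Ps ! i)"
  using complements_in_NC length_complements_eq by (simp add: NC_def)

text \<open>
  For \<open>i < j\<close>, the complement with index \<open>i\<close> is below \<open>level (Suc i)\<close> and hence below \<open>level j\<close>, so its
  chords are chords of \<open>level j\<close>. The complement with index \<open>j\<close> is below the complement of \<open>level j\<close>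
  and crosses none of those.
\<close>

lemma shuffle_complements_in_NC: "shuffle_parts (complements n Ps) \<in> NC (k * n)"
proof -
  have "aligned (complements n Ps ! i) (complements n Ps ! j)" if ij: "i < j" "j < k" for i j
    unfolding aligned_def
  proof (intro allI impI)
    fix b d assume "same_block (complements n Ps ! j) b d"
    then have gap: "gap_equiv (level j) b d" using same_block_complements[OF ij(2)] by simp
    have "same_block (level j) a c" if "same_block (complements n Ps ! i) a c" for a c
      using that same_block_complements[of i] same_block_level_mono[of "Suc i" j] ij by simp
    then show "gap_equiv (complements n Ps ! i) b d" using gap unfolding gap_equiv_def by blast
  qed
  moreover have "noncrossing (complements n Ps ! i)" if "i < k" for i
    using complements_in_NC[OF that] by (rule NC_D)
  moreover have "shuffle_parts (complements n Ps) \<in> NC (length (complements n Ps) * n) \<longleftrightarrow>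
      (\<forall>i<length (complements n Ps). noncrossing (complements n Ps ! i)) \<and>
      (\<forall>i j. i < j \<longrightarrow> j < length (complements n Ps) \<longrightarrow>
        aligned (complements n Ps ! i) (complements n Ps ! j))"
    by (rule shuffle_parts_in_NC_iff) (rule partition_on_complements)
  ultimately show ?thesis by (simp add: length_complements_eq)
qed

text \<open>
  Each level is recovered from the next one and a complement; starting from the one-block partition
  at the top, all complements together determine the bottom level.
\<close>

lemma same_block_level_0:
  "same_block (level 0) x y \<longleftrightarrow>
     x \<in> {1..n} \<and> y \<in> {1..n} \<and> (\<forall>i<k. point_equiv (complements n Ps ! i) x y)"
proof -
  have "same_block (level 0) x y \<longleftrightarrow>
      same_block (level j) x y \<and> (\<forall>i<j. point_equiv (complements n Ps ! i) x y)" if "j \<le> k" for j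
    using that
  proof (induction j)
    case (Suc j)
    then show ?case using same_block_level[of j x y] by (auto simp: less_Suc_eq)
  qed simp
  from this[of k] show ?thesis unfolding level_last same_block_top_part by simp
qed

end

text \<open>
  The levels agree from the top down, by injectivity of relative complementation.
\<close>

lemma complements_inj:
  assumes n: "1 \<le> n" and k: "1 \<le> k" and Ps: "Ps \<in> multichains n k" and Rs: "Rs \<in> multichains n k"
    and eq: "complements n Ps = complements n Rs"
  shows "Ps = Rs"
proof -
  interpret P: multichain n k Ps using n k Ps by unfold_locales
  interpret R: multichain n k Rs using n k Rs by unfold_locales
  have level: "P.level i = R.level i" if "i \<le> k" for i
    using that
  proof (induction rule: inc_induct)
    case base
    show ?case by (simp add: P.level_last R.level_last)
  next
    case (step i)
    have "kreweras_rel (P.level (Suc i)) (P.level i) = kreweras_rel (P.level (Suc i)) (R.level i)"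
      using P.complements_level[of i] R.complements_level[of i] eq step by simp
    moreover have "refines (R.level i) (P.level (Suc i))"
      using R.level_refines[of i "Suc i"] step by simp
    ultimately show ?case
      using step kreweras_rel_inj[of "P.level (Suc i)" n "P.level i" "R.level i"]
        P.level_in_NC R.level_in_NC P.level_refines[of i "Suc i"] by simp
  qed
  show ?thesis
    by (rule nth_equalityI) (use level P.level_nth R.level_nth P.length_Ps R.length_Ps in auto)
qed

text \<open>
  The last entry \<open>Q\<close> determines the last level \<open>P\<close> by \<open>K\<^sup>N(P) = Q\<close>. The remaining entries do not cross
  \<open>Q\<close> and are below \<open>N\<close>, so by \<open>same_block_iff_kreweras_rel\<close> they are below \<open>P\<close>, and the argument can be
  repeated with \<open>P\<close> for \<open>N\<close>.
\<close>

lemma multichain_exists: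
  assumes "N \<in> NC n"
    and "\<And>Q. Q \<in> set Qs \<Longrightarrow> Q \<in> NC n \<and> refines Q N"
    and "sorted_wrt aligned Qs"
  shows "\<exists>Ps. length Ps = length Qs \<and> set Ps \<subseteq> NC n \<and> sorted_wrt refines (Ps @ [N]) \<and>
           (\<forall>i<length Qs. Qs ! i = kreweras_rel ((Ps @ [N]) ! Suc i) (Ps ! i))"
  using assms
proof (induction Qs arbitrary: N rule: rev_induct)
  case (snoc Q Qs)
  have Q: "Q \<in> NC n" "refines Q N" using snoc.prems(2) by auto
  obtain P where P: "P \<in> NC n" "refines P N" "kreweras_rel N P = Q"
    using kreweras_rel_surj[OF snoc.prems(1) Q] by blast
  have "R \<in> NC n \<and> refines R P" if "R \<in> set Qs" for R
  proof -
    have R: "R \<in> NC n" "refines R N" using snoc.prems(2) that by auto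
    have "aligned R Q" using snoc.prems(3) that by (auto simp: sorted_wrt_append)
    then have "\<forall>a c. same_block R a c \<longrightarrow> same_block P a c"
      using R(2) unfolding refines_NC_iff[OF R(1) snoc.prems(1)] aligned_iff_point_equiv
        same_block_iff_kreweras_rel[OF P(1) snoc.prems(1) P(2)] P(3) by blast
    with R show ?thesis using refines_NC_iff[OF R(1) P(1)] by blast
  qed
  moreover have "sorted_wrt aligned Qs" using snoc.prems(3) by (simp add: sorted_wrt_append)
  ultimately obtain Ps where Ps: "length Ps = length Qs" "set Ps \<subseteq> NC n"
    "sorted_wrt refines (Ps @ [P])"
    "\<forall>i<length Qs. Qs ! i = kreweras_rel ((Ps @ [P]) ! Suc i) (Ps ! i)"
    using snoc.IH[OF P(1)] by blast
  show ?case
  proof (intro exI[of _ "Ps @ [P]"] conjI allI impI)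
    show "length (Ps @ [P]) = length (Qs @ [Q])" using Ps by simp
    show "set (Ps @ [P]) \<subseteq> NC n" using Ps P by simp
    show "sorted_wrt refines ((Ps @ [P]) @ [N])"
      using Ps(3) P(2) refines_transitive[OF _ P(2)] by (auto simp: sorted_wrt_append)
    fix i assume "i < length (Qs @ [Q])"
    then show "(Qs @ [Q]) ! i = kreweras_rel (((Ps @ [P]) @ [N]) ! Suc i) ((Ps @ [P]) ! i)"
      using Ps(1,4) P(3) by (cases "i = length Qs") (auto simp: nth_append less_Suc_eq)
  qed
qed simp

lemma shuffle_parts_inj:
  assumes Qs: "\<And>i. i < length Qs \<Longrightarrow> partition_on {1..n} (Qs ! i)"
    and Rs: "\<And>i. i < length Rs \<Longrightarrow> partition_on {1..n} (Rs ! i)"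
    and len: "length Qs = length Rs" and eq: "shuffle_parts Qs = shuffle_parts Rs"
  shows "Qs = Rs"
proof (rule nth_equalityI[OF len])
  fix i assume i: "i < length Qs"
  show "Qs ! i = Rs ! i"
  proof (rule partition_on_eqI)
    show parts: "partition_on {1..n} (Qs ! i)" "partition_on {1..n} (Rs ! i)" using Qs Rs i len by auto
    fix x y
    show "same_block (Qs ! i) x y \<longleftrightarrow> same_block (Rs ! i) x y"
    proof (cases "x \<in> {1..n} \<and> y \<in> {1..n}")
      case True
      then show ?thesis
        using same_block_shuffle_pos[of Qs n i i x y] same_block_shuffle_pos[of Rs n i i x y]
          Qs Rs i len eq by simp
    next
      case False
      then show ?thesis using same_block_in[OF parts(1)] same_block_in[OF parts(2)] by blast
    qed
  qed
qed

lemma shuffle_parts_exists: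
  assumes S: "S \<in> NC (k * n)"
    and res: "\<And>u v. same_block S u v \<Longrightarrow> u mod k = v mod k"
  obtains Qs where "length Qs = k" "\<And>i. i < k \<Longrightarrow> partition_on {1..n} (Qs ! i)" "shuffle_parts Qs = S"
proof -
  note part_S = NC_D(1)[OF S]
  have "\<exists>Q. partition_on {1..n} Q \<and>
      (\<forall>x y. same_block Q x y \<longleftrightarrow> x \<in> {1..n} \<and> y \<in> {1..n} \<and> same_block S (pos k i x) (pos k i y))"
    if "i < k" for i
  proof (rule partition_of_equivalence)
    show "same_block S (pos k i x) (pos k i x)" if "x \<in> {1..n}" for x
      using same_block_refl_iff[OF part_S] pos_range[of x n i k] that \<open>i < k\<close> by simp
  qed (blast intro: same_block_sym same_block_trans[OF part_S])+
  then obtain f where f: "\<And>i. i < k \<Longrightarrow> partition_on {1..n} (f i)"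
    "\<And>i x y. i < k \<Longrightarrow> same_block (f i) x y \<longleftrightarrow>
       x \<in> {1..n} \<and> y \<in> {1..n} \<and> same_block S (pos k i x) (pos k i y)"
    by metis
  define Qs where "Qs = map f [0..<k]"
  have len: "length Qs = k" and nth: "i < k \<Longrightarrow> Qs ! i = f i" for i by (simp_all add: Qs_def)
  have parts: "partition_on {1..n} (Qs ! i)" if "i < length Qs" for i
    using f(1) that by (simp add: len nth)
  have part_Qs: "partition_on {1..k * n} (shuffle_parts Qs)"
    using partition_on_shuffle_parts[of Qs n] parts by (simp add: len)
  have "shuffle_parts Qs = S"
  proof (rule partition_on_eqI[OF part_Qs part_S])
    fix u v
    show "same_block (shuffle_parts Qs) u v \<longleftrightarrow> same_block S u v"
    proof (cases "u \<in> {1..k * n} \<and> v \<in> {1..k * n}")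
      case False
      then show ?thesis using same_block_in[OF part_S] same_block_in[OF part_Qs] by blast
    next
      case True
      obtain i x where u: "i < k" "1 \<le> x" "x \<le> n" "u = pos k i x" using pos_cases[of u k n] True by auto
      obtain j y where v: "j < k" "1 \<le> y" "y \<le> n" "v = pos k j y" using pos_cases[of v k n] True by auto
      have "i = j" if "same_block S u v"
      proof -
        have "Suc i mod k = Suc j mod k" using res[OF that] u v by (simp add: pos_mod)
        then show ?thesis using u(1) v(1) by (auto simp: mod_Suc split: if_splits)
      qed
      then show ?thesis
        using same_block_shuffle_pos[of Qs n i j x y] parts u v f(2)[of i x y]
        by (auto simp: len nth)
    qed
  qed
  then show thesis using that len parts by simp
qed

lemma multichain_of_noncrossing_shuffle:
  assumes n: "1 \<le> n" and k: "1 \<le> k" and S: "S \<in> NC (k * n)"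
    and res: "\<And>u v. same_block S u v \<Longrightarrow> u mod k = v mod k"
  obtains Ps where "Ps \<in> multichains n k" "shuffle_parts (complements n Ps) = S"
proof -
  obtain Qs where Qs: "length Qs = k" "\<And>i. i < k \<Longrightarrow> partition_on {1..n} (Qs ! i)" "shuffle_parts Qs = S"
    using shuffle_parts_exists[OF S res] by blast
  have nc: "\<forall>i<k. noncrossing (Qs ! i)" and al: "\<forall>i j. i < j \<longrightarrow> j < k \<longrightarrow> aligned (Qs ! i) (Qs ! j)"
    using shuffle_parts_in_NC_iff[of Qs n] Qs S by simp_all
  have "Q \<in> NC n \<and> refines Q (top_part n)" if "Q \<in> set Qs" for Q
  proof -
    have "Q \<in> NC n" using that Qs nc by (auto simp: in_set_conv_nth NC_def)
    then show ?thesis using refines_top_part by blast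
  qed
  moreover have "sorted_wrt aligned Qs" using al Qs(1) by (simp add: sorted_wrt_iff_nth_less)
  ultimately obtain Ps where Ps: "length Ps = k" "set Ps \<subseteq> NC n"
    "sorted_wrt refines (Ps @ [top_part n])"
    "\<forall>i<k. Qs ! i = kreweras_rel ((Ps @ [top_part n]) ! Suc i) (Ps ! i)"
    using multichain_exists[OF top_part_in_NC[OF n], of Qs] Qs(1) by auto
  have "Ps \<noteq> []" using Ps(1) k by auto
  then have "complements n Ps = Qs"
    using length_complements[of Ps n] complements_nth[OF n Ps(2)] Ps Qs(1)
    by (intro nth_equalityI) auto
  moreover have "Ps \<in> multichains n k" using Ps by (simp add: multichains_def sorted_wrt_append)
  ultimately show thesis using that Qs(3) by blast
qed

section \<open>Block sizes and residues\<close>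

text \<open>
  The interval between two related gaps is a union of blocks, so its size is a multiple of \<open>k\<close>.
\<close>

lemma kreweras_residues_of_block_sizes:
  assumes P: "P \<in> NC m" and size: "\<And>B. B \<in> P \<Longrightarrow> card B = k"
    and uv: "same_block (kreweras m P) u v"
  shows "u mod k = v mod k"
proof -
  have dvd: "k dvd v - u" if "u < v" "v \<le> m" "gap_equiv P u v" for u v
  proof -
    let ?C = "{B \<in> P. B \<subseteq> {u<..v}}"
    have union: "\<Union>?C = {u<..v}"
    proof (rule set_eqI, rule iffI)
      fix a assume a: "a \<in> {u<..v}"
      then have "a \<in> {1..m}" using that by simp
      then obtain B where B: "B \<in> P" "a \<in> B" using partition_onD1[OF NC_D(1)[OF P]] by blast
      have "c \<in> {u<..v}" if "c \<in> B" for c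
      proof -
        have "same_block P a c" using B that by (auto simp: same_block_def)
        then show ?thesis using gap_equiv_leD[OF \<open>gap_equiv P u v\<close>] a by simp
      qed
      then show "a \<in> \<Union>?C" using B by blast
    qed blast
    have "k * card ?C = card (\<Union>?C)"
    proof (rule card_partition)
      show "finite (\<Union>?C)" unfolding union by simp
      then show "finite ?C" by (rule finite_UnionD)
      show "card B = k" if "B \<in> ?C" for B using size that by simp
      show "B \<inter> D = {}" if "B \<in> ?C" "D \<in> ?C" "B \<noteq> D" for B D
        using partition_onD2[OF NC_D(1)[OF P]] that by (auto simp: disjoint_def)
    qed
    then have "k * card ?C = v - u" unfolding union by simp
    then show ?thesis by (metis dvd_triv_left)
  qed
  have *: "u \<le> m" "v \<le> m" "gap_equiv P u v" using uv kreweras_characterization(2)[OF P] by auto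
  show ?thesis
  proof (cases u v rule: linorder_cases)
    case less
    then show ?thesis using dvd[of u v] * mod_eq_dvd_iff_nat[of u v k] by simp
  next
    case greater
    then show ?thesis using dvd[of v u] * gap_equiv_sym[of P u v] mod_eq_dvd_iff_nat[of v u k] by simp
  qed simp
qed

context
  fixes m k :: nat and P :: "nat set set"
  assumes k: "1 \<le> k" and P: "P \<in> NC m" and km: "k dvd m"
    and res: "\<And>u v. same_block (kreweras m P) u v \<Longrightarrow> u mod k = v mod k"
begin

text \<open>
  If \<open>w\<close> follows \<open>z\<close> cyclically in a block, then the gap after \<open>z\<close> is related to the gap before \<open>w\<close>,
  whence \<open>w\<close> is congruent to \<open>z + 1\<close>. Going once around the block shows that \<open>k\<close> divides its size. As
  \<open>k\<close> divides \<open>m\<close>, the gap \<open>m\<close> can stand for the gap before \<open>1\<close>.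
\<close>

lemma block_residues:
  assumes B: "B \<in> P"
  defines "xs \<equiv> sorted_list_of_set B"
  shows "i < card B \<Longrightarrow> xs ! i mod k = (xs ! 0 + i) mod k"
    and "k dvd card B"
proof -
  note part = NC_D(1)[OF P]
  have sub: "B \<subseteq> {1..m}" using partition_onD1[OF part] B by blast
  then have fin: "finite B" by (rule finite_subset) simp
  have ne: "B \<noteq> {}" using partition_onD3[OF part] B by auto
  have card: "0 < card B" using fin ne by (simp add: card_gt_0_iff)
  have len: "length xs = card B" and set_xs: "set xs = B" and sorted: "sorted_wrt (<) xs"
    using fin by (simp_all add: xs_def)
  have mem: "xs ! i \<in> B" if "i < card B" for i using that len set_xs nth_mem by metis
  have less: "xs ! i < xs ! j" if "i < j" "j < card B" for i j
    using sorted_wrt_nth_less[OF sorted] that len by simp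
  have idx: "\<exists>i<card B. xs ! i = v" if "v \<in> B" for v
    using that set_xs len by (metis in_set_conv_nth)
  have block: "same_block P a v \<longleftrightarrow> v \<in> B" if "a \<in> B" for a v
    using block_eq_Collect[OF part B that] by auto
  have m: "1 \<le> m" using sub ne by auto
  have pair: "noncrossing_pair {1..m} P (top_part m)"
    using noncrossing_pairI[OF P top_part_in_NC[OF m] refines_top_part[OF P]] .
  have kre: "u mod k = v mod k" if "u \<in> {1..m}" "v \<in> {1..m}" "gap_equiv P u v" for u v
    using res[of u v] kreweras_characterization(2)[OF P, of u v] that by blast
  have step: "xs ! Suc i mod k = Suc (xs ! i) mod k" if i: "Suc i < card B" for i
  proof -
    let ?z = "xs ! i" and ?w = "xs ! Suc i"
    have zw: "?z \<in> B" "?w \<in> B" "?z < ?w" using mem less i by auto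
    then have range: "1 \<le> ?z" "?w \<le> m" using sub by auto
    have between: "v \<le> ?z \<or> ?w \<le> v" if v: "v \<in> B" for v
    proof -
      obtain j where j: "j < card B" "xs ! j = v" using idx[OF v] by blast
      show ?thesis
      proof (cases "j \<le> i")
        case True
        then show ?thesis using less[of j i] i j by (cases "j = i") auto
      next
        case False
        then show ?thesis using less[of "Suc i" j] j by (cases "j = Suc i") auto
      qed
    qed
    have "gap_equiv P ?z (?w - 1)"
    proof (rule noncrossing_pair.gap_equiv_after[OF pair \<open>?z < ?w\<close>])
      show "same_block P ?z ?w" using block zw by simp
      show "v \<le> ?z \<or> ?w \<le> v" if "same_block P ?z v" for v using that block zw between by simp
      show "same_block (top_part m) ?z (?w - 1)"
        unfolding same_block_top_part using range zw by auto
      show "v \<le> ?w - 1 \<or> ?w \<le> v" for v by linarith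
    qed (use zw in auto)
    then have "?z mod k = (?w - 1) mod k" using range zw by (intro kre) auto
    then have "Suc ?z mod k = Suc (?w - 1) mod k" by (metis mod_Suc_eq)
    then show ?thesis using zw by simp
  qed
  have residue: "xs ! i mod k = (xs ! 0 + i) mod k" if "i < card B" for i
    using that
  proof (induction i)
    case (Suc i)
    then have "xs ! Suc i mod k = Suc (xs ! i) mod k" using step by simp
    also have "\<dots> = Suc (xs ! 0 + i) mod k" using Suc by (metis Suc_lessD mod_Suc_eq)
    finally show ?case by simp
  qed simp
  then show "i < card B \<Longrightarrow> xs ! i mod k = (xs ! 0 + i) mod k" .
  define w z where "w = xs ! 0" and "z = xs ! (card B - 1)"
  have wz: "w \<in> B" "z \<in> B" using mem card by (auto simp: w_def z_def)
  have extremes: "w \<le> v \<and> v \<le> z" if v: "v \<in> B" for v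
  proof -
    obtain j where j: "j < card B" "xs ! j = v" using idx[OF v] by blast
    have "w \<le> v" using less[of 0 j] j by (cases "j = 0") (auto simp: w_def)
    moreover have "v \<le> z"
    proof (cases "j = card B - 1")
      case False
      then have "j < card B - 1" using j by linarith
      then show ?thesis using less[of j "card B - 1"] j by (simp add: z_def)
    qed (use j in \<open>simp add: z_def\<close>)
    ultimately show ?thesis ..
  qed
  have range: "1 \<le> w" "w \<le> z" "z \<le> m" using wz sub extremes by auto
  have "z mod k = (w - 1) mod k"
  proof (cases "w = 1")
    case False
    then have w: "1 \<le> w - 1" "w - 1 < w" using range by auto
    have "gap_equiv P (w - 1) z"
    proof (rule noncrossing_pair.gap_equiv_before[OF pair \<open>w \<le> z\<close> _ _ w(2)])
      show "same_block P w z" using block wz by simp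
      show "w \<le> v \<and> v \<le> z" if "same_block P w v" for v using that block wz extremes by simp
      show "same_block (top_part m) (w - 1) w" unfolding same_block_top_part using w range by auto
      show "v \<le> w - 1 \<or> w \<le> v" for v by linarith
    qed
    then have "(w - 1) mod k = z mod k" using w range by (intro kre) auto
    then show ?thesis by simp
  next
    case True
    have "gap_equiv P z m"
    proof (rule noncrossing_pair.gap_equiv_max[OF pair \<open>z \<le> m\<close>])
      show "same_block P w z" using block wz by simp
      show "v \<le> z" if "same_block P w v" for v using that block wz extremes by simp
      show "same_block (top_part m) w m" unfolding same_block_top_part using range by auto
      show "w \<le> v \<and> v \<le> m" if "same_block (top_part m) w v" for v
        using that True unfolding same_block_top_part by auto
    qed
    then have "z mod k = m mod k" using range m by (intro kre) auto
    then show ?thesis using km True by simp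
  qed
  moreover have "z mod k = (w + (card B - 1)) mod k"
    using residue[of "card B - 1"] card by (simp add: w_def z_def)
  ultimately have "k dvd (w + (card B - 1)) - (w - 1)"
    using mod_eq_dvd_iff_nat[of "w - 1" "w + (card B - 1)" k] by simp
  moreover have "(w + (card B - 1)) - (w - 1) = card B" using range card by simp
  ultimately show "k dvd card B" by simp
qed

text \<open>
  Along a block the residues run cyclically through all of \<open>\<int>/k\<close>, so the elements congruent to \<open>1\<close> are
  every \<open>k\<close>-th one.
\<close>

lemma card_block_iff:
  assumes B: "B \<in> P"
  shows "card B = k \<longleftrightarrow> (\<forall>x\<in>B. \<forall>y\<in>B. x mod k = 1 mod k \<longrightarrow> y mod k = 1 mod k \<longrightarrow> x = y)"
proof -
  define xs where "xs = sorted_list_of_set B"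
  note residue = block_residues(1)[OF B, folded xs_def] and dvd = block_residues(2)[OF B]
  have "B \<subseteq> {1..m}" using partition_onD1[OF NC_D(1)[OF P]] B by blast
  then have fin: "finite B" by (rule finite_subset) simp
  have "B \<noteq> {}" using partition_onD3[OF NC_D(1)[OF P]] B by auto
  then have card: "0 < card B" using fin by (simp add: card_gt_0_iff)
  have len: "length xs = card B" and set_xs: "set xs = B" and dist: "distinct xs"
    using fin by (simp_all add: xs_def)
  show ?thesis
  proof
    assume size: "card B = k"
    show "\<forall>x\<in>B. \<forall>y\<in>B. x mod k = 1 mod k \<longrightarrow> y mod k = 1 mod k \<longrightarrow> x = y"
    proof (intro ballI impI)
      fix x y assume xy: "x \<in> B" "y \<in> B" "x mod k = 1 mod k" "y mod k = 1 mod k"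
      obtain i j where ij: "i < k" "x = xs ! i" "j < k" "y = xs ! j"
        using xy(1,2) set_xs len size by (metis in_set_conv_nth)
      have *: "i = j" if "(xs ! 0 + i) mod k = (xs ! 0 + j) mod k" "i \<le> j" "j < k" for i j
      proof -
        have "k dvd j - i" using that mod_eq_dvd_iff_nat[of "xs ! 0 + i" "xs ! 0 + j" k] by simp
        then show ?thesis using that by (auto dest: dvd_imp_le)
      qed
      have "(xs ! 0 + i) mod k = (xs ! 0 + j) mod k"
        using xy ij residue[of i] residue[of j] size by simp
      then have "i = j" using *[of i j] *[of j i] ij by (cases "i \<le> j") auto
      then show "x = y" using ij by simp
    qed
  next
    assume uniq: "\<forall>x\<in>B. \<forall>y\<in>B. x mod k = 1 mod k \<longrightarrow> y mod k = 1 mod k \<longrightarrow> x = y"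
    show "card B = k"
    proof (rule ccontr)
      assume "card B \<noteq> k"
      obtain q where q: "card B = k * q" using dvd by blast
      have "q \<noteq> 0" "q \<noteq> 1" using card q \<open>card B \<noteq> k\<close> by (auto intro: Nat.gr0I)
      then have "k * 2 \<le> card B" unfolding q by (intro mult_le_mono2) simp
      define c where "c = xs ! 0"
      \<comment> \<open>The index \<open>i\<close> solves \<open>c + i \<equiv> 1\<close> modulo \<open>k\<close>; adding \<open>k * c\<close> keeps the subtraction exact.\<close>
      define i where "i = (k * c + 1 - c) mod k"
      have "i < k" using k by (simp add: i_def)
      have "c \<le> k * c" using k by simp
      have ci: "(c + i) mod k = 1 mod k"
      proof -
        have "(c + i) mod k = (c + (k * c + 1 - c)) mod k" unfolding i_def by (simp add: mod_add_right_eq)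
        also have "c + (k * c + 1 - c) = 1 + k * c" using \<open>c \<le> k * c\<close> by linarith
        also have "(1 + k * c) mod k = 1 mod k" by (rule mod_mult_self2)
        finally show ?thesis .
      qed
      have ik: "i < card B" "i + k < card B" using \<open>i < k\<close> \<open>k * 2 \<le> card B\<close> by auto
      have "xs ! i mod k = 1 mod k" using residue[OF ik(1)] ci by (simp add: c_def)
      moreover have "xs ! (i + k) mod k = 1 mod k"
      proof -
        have "(c + (i + k)) mod k = (c + i + k) mod k" by (simp add: add.assoc)
        also have "\<dots> = (c + i) mod k" by (rule mod_add_self2)
        finally show ?thesis using residue[OF ik(2)] ci by (simp add: c_def)
      qed
      moreover have "xs ! i \<in> B" "xs ! (i + k) \<in> B" using ik len set_xs nth_mem by metis+
      ultimately have "xs ! i = xs ! (i + k)" using uniq by blast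
      then show False using nth_eq_iff_index_eq[OF dist] ik len k by simp
    qed
  qed
qed

end

section \<open>The bottom of the multichain\<close>

lemma shuffle_residues:
  assumes parts: "\<And>i. i < length Qs \<Longrightarrow> partition_on {1..n} (Qs ! i)"
    and uv: "same_block (shuffle_parts Qs) u v"
  shows "u mod length Qs = v mod length Qs"
proof -
  obtain i x y where "i < length Qs" "1 \<le> x" "1 \<le> y" "u = pos (length Qs) i x" "v = pos (length Qs) i y"
    using same_block_shuffleE[OF parts uv] by blast
  then show ?thesis by (simp add: pos_mod)
qed

text \<open>
  The places with index \<open>0\<close> are the first of their groups, so a gap \<open>b\<close> of any of the partitions is to
  the left of \<open>pos k 0 x\<close> iff \<open>b < x\<close>.
\<close>

lemma point_equiv_shuffle_first:
  assumes parts: "\<And>i. i < length Qs \<Longrightarrow> partition_on {1..n} (Qs ! i)"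
    and k: "0 < length Qs" and xy: "1 \<le> x" "1 \<le> y"
  shows "point_equiv (shuffle_parts Qs) (pos (length Qs) 0 x) (pos (length Qs) 0 y) \<longleftrightarrow>
           (\<forall>i<length Qs. point_equiv (Qs ! i) x y)"
proof -
  let ?k = "length Qs"
  have less: "pos ?k i b < pos ?k 0 x \<longleftrightarrow> b < x" if "i < ?k" "1 \<le> b" "1 \<le> x" for i b x
    using pos_less_iff[of b i ?k x 0] that k by simp
  show ?thesis
  proof (intro iffI allI impI)
    fix i assume S: "point_equiv (shuffle_parts Qs) (pos ?k 0 x) (pos ?k 0 y)" and i: "i < ?k"
    show "point_equiv (Qs ! i) x y"
      unfolding point_equiv_def
    proof (intro allI impI)
      fix b d assume bd: "same_block (Qs ! i) b d"
      then have ge: "1 \<le> b" "1 \<le> d" using same_block_in[OF parts[OF i] bd] by auto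
      have "same_block (shuffle_parts Qs) (pos ?k i b) (pos ?k i d)"
        using i bd unfolding same_block_shuffle_parts by blast
      then have "(pos ?k i b < pos ?k 0 x \<longleftrightarrow> pos ?k i b < pos ?k 0 y) \<longleftrightarrow>
          (pos ?k i d < pos ?k 0 x \<longleftrightarrow> pos ?k i d < pos ?k 0 y)"
        using S unfolding point_equiv_def by blast
      then show "(b < x \<longleftrightarrow> b < y) \<longleftrightarrow> (d < x \<longleftrightarrow> d < y)" using less i ge xy by simp
    qed
  next
    assume Q: "\<forall>i<?k. point_equiv (Qs ! i) x y"
    show "point_equiv (shuffle_parts Qs) (pos ?k 0 x) (pos ?k 0 y)"
      unfolding point_equiv_def
    proof (intro allI impI)
      fix u v assume "same_block (shuffle_parts Qs) u v"
      then obtain i b d where *: "i < ?k" "1 \<le> b" "1 \<le> d" "same_block (Qs ! i) b d"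
        "u = pos ?k i b" "v = pos ?k i d"
        using same_block_shuffleE[OF parts] by blast
      then have "(b < x \<longleftrightarrow> b < y) \<longleftrightarrow> (d < x \<longleftrightarrow> d < y)"
        using Q unfolding point_equiv_def by blast
      then show "(u < pos ?k 0 x \<longleftrightarrow> u < pos ?k 0 y) \<longleftrightarrow> (v < pos ?k 0 x \<longleftrightarrow> v < pos ?k 0 y)"
        using less * xy by simp
    qed
  qed
qed

lemma bot_part_in_NC: "bot_part n \<in> NC n"
  unfolding NC_def bot_part_def by (auto simp: partition_on_singletons noncrossing_def)

lemma same_block_bot_part: "same_block (bot_part n) x y \<longleftrightarrow> x = y \<and> x \<in> {1..n}"
  by (auto simp: same_block_def bot_part_def)

lemma refines_bot_part: "P \<in> NC n \<Longrightarrow> refines (bot_part n) P"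
  unfolding refines_NC_iff[OF bot_part_in_NC] same_block_bot_part
  using same_block_refl_iff[OF NC_D(1)] by blast

lemma all_same_block_iff:
  "(\<forall>u v. same_block P u v \<longrightarrow> R u v) \<longleftrightarrow> (\<forall>B\<in>P. \<forall>u\<in>B. \<forall>v\<in>B. R u v)"
  by (auto simp: same_block_def)

context multichain
begin

context
  fixes P
  assumes P: "P \<in> NC (k * n)" and K: "kreweras (k * n) P = shuffle_parts (complements n Ps)"
begin

text \<open>
  Both sides say that the same chords of all complements pass over \<open>x\<close> and \<open>y\<close>.
\<close>

lemma same_block_first_residue:
  assumes "x \<in> {1..n}" "y \<in> {1..n}"
  shows "same_block P (pos k 0 x) (pos k 0 y) \<longleftrightarrow> same_block (level 0) x y"
proof -
  have kn: "1 \<le> k * n" using k n by simp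
  have range: "pos k 0 x \<in> {1..k * n}" "pos k 0 y \<in> {1..k * n}"
    using pos_range[of _ n 0 k] k assms by simp_all
  have "same_block P (pos k 0 x) (pos k 0 y) \<longleftrightarrow>
      point_equiv (kreweras (k * n) P) (pos k 0 x) (pos k 0 y)"
    using same_block_iff_kreweras_rel[OF P top_part_in_NC[OF kn] refines_top_part[OF P]] range
    by (simp only: kreweras_eq_kreweras_rel[OF kn P] same_block_top_part simp_thms)
  also have "\<dots> \<longleftrightarrow> (\<forall>i<k. point_equiv (complements n Ps ! i) x y)"
    using point_equiv_shuffle_first[OF partition_on_complements, of x y] assms k
    by (simp add: K length_complements_eq)
  also have "\<dots> \<longleftrightarrow> same_block (level 0) x y" using same_block_level_0 assms by simp
  finally show ?thesis .
qed

text \<open>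
  Every block has size \<open>k\<close> iff no two elements congruent to \<open>1\<close> share a block, and those
  elements carry a copy of the bottom level.
\<close>

lemma block_sizes_iff_bottom_first: "(\<forall>B\<in>P. card B = k) \<longleftrightarrow> level 0 = bot_part n"
proof -
  have res: "u mod k = v mod k" if "same_block (kreweras (k * n) P) u v" for u v
    using shuffle_residues[OF partition_on_complements] that by (simp add: K length_complements_eq)
  note part = NC_D(1)[OF P]
  note part_0 = NC_D(1)[OF level_in_NC[of 0, simplified]]
  have first: "pos k 0 x mod k = 1 mod k" if "1 \<le> x" for x
    using pos_mod[of x 0 k] that k by simp
  have firstE: "\<exists>x\<in>{1..n}. u = pos k 0 x" if "u \<in> {1..k * n}" "u mod k = 1 mod k" for u
  proof -
    obtain i x where u: "i < k" "1 \<le> x" "x \<le> n" "u = pos k i x" using pos_cases[of u k n] \<open>u \<in> {1..k * n}\<close> by auto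
    then have "Suc i mod k = Suc 0 mod k" using that pos_mod[of x i k] by simp
    then have "i = 0" using u(1) by (auto simp: mod_Suc split: if_splits)
    then show ?thesis using u by auto
  qed
  have "(\<forall>B\<in>P. card B = k) \<longleftrightarrow>
      (\<forall>u v. same_block P u v \<longrightarrow> u mod k = 1 mod k \<longrightarrow> v mod k = 1 mod k \<longrightarrow> u = v)"
    using card_block_iff[OF k P dvd_triv_left res] unfolding all_same_block_iff by simp
  also have "\<dots> \<longleftrightarrow> (\<forall>x y. same_block (level 0) x y \<longrightarrow> x = y)"
  proof (intro iffI allI impI)
    fix x y
    assume *: "\<forall>u v. same_block P u v \<longrightarrow> u mod k = 1 mod k \<longrightarrow> v mod k = 1 mod k \<longrightarrow> u = v"
      and xy: "same_block (level 0) x y"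
    have mem: "x \<in> {1..n}" "y \<in> {1..n}" using same_block_in[OF part_0 xy] by auto
    then have "same_block P (pos k 0 x) (pos k 0 y)" using same_block_first_residue xy by simp
    then have "pos k 0 x = pos k 0 y" using * first mem by simp
    then show "x = y" using pos_eq_iff[of x 0 k y 0] mem k by simp
  next
    fix u v
    assume *: "\<forall>x y. same_block (level 0) x y \<longrightarrow> x = y" and uv: "same_block P u v"
      and "u mod k = 1 mod k" "v mod k = 1 mod k"
    then obtain x y where "x \<in> {1..n}" "u = pos k 0 x" "y \<in> {1..n}" "v = pos k 0 y"
      using firstE[of u] firstE[of v] same_block_in[OF part uv] by blast
    then show "u = v" using * uv same_block_first_residue[of x y] by blast
  qed
  also have "\<dots> \<longleftrightarrow> level 0 = bot_part n"
  proof
    assume *: "\<forall>x y. same_block (level 0) x y \<longrightarrow> x = y"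
    show "level 0 = bot_part n"
    proof (rule partition_on_eqI[OF part_0 NC_D(1)[OF bot_part_in_NC]])
      show "same_block (level 0) x y \<longleftrightarrow> same_block (bot_part n) x y" for x y
        using * same_block_refl_iff[OF part_0, of x] same_block_in[OF part_0, of x y]
        unfolding same_block_bot_part by auto
    qed
  qed (simp add: same_block_bot_part)
  finally show ?thesis .
qed

end

end

theorem corollary4p3p11:
  fixes n k :: nat
  assumes "n \<ge> 1" and "k \<ge> 1"
  shows "bij_betw (\<lambda>Ps. nabla n (bot_part n # Ps))
           (multichains n (k - 1))
           {P \<in> NC (k * n). \<forall>B\<in>P. card B = k}"
proof -
  let ?F = "\<lambda>Ps. nabla n (bot_part n # Ps)"
  let ?S = "\<lambda>Ps. shuffle_parts (complements n (bot_part n # Ps))"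
  have "1 \<le> k * n" using assms by simp
  note bij = bij_betw_kreweras[OF this]
  have chain: "multichain n k (bot_part n # Ps)" if "Ps \<in> multichains n (k - 1)" for Ps
  proof
    show "bot_part n # Ps \<in> multichains n k"
      using that assms bot_part_in_NC refines_bot_part by (auto simp: multichains_def)
  qed (use assms in auto)
  have F: "?F Ps \<in> NC (k * n)" "kreweras (k * n) (?F Ps) = ?S Ps"
    if "Ps \<in> multichains n (k - 1)" for Ps
  proof -
    interpret multichain n k "bot_part n # Ps" using chain[OF that] .
    have F_eq: "?F Ps = inv_into (NC (k * n)) (kreweras (k * n)) (?S Ps)"
      by (simp only: nabla_def complements_def length_Ps Let_def)
    have "?S Ps \<in> kreweras (k * n) ` NC (k * n)"
      using shuffle_complements_in_NC bij by (simp add: bij_betw_def)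
    then show "?F Ps \<in> NC (k * n)" "kreweras (k * n) (?F Ps) = ?S Ps"
      unfolding F_eq by (simp_all add: inv_into_into f_inv_into_f)
  qed
  show ?thesis
    unfolding bij_betw_def
  proof
    show "inj_on ?F (multichains n (k - 1))"
    proof (rule inj_onI)
      fix Ps Rs
      assume Ps: "Ps \<in> multichains n (k - 1)" and Rs: "Rs \<in> multichains n (k - 1)" and eq: "?F Ps = ?F Rs"
      interpret P: multichain n k "bot_part n # Ps" using chain[OF Ps] .
      interpret R: multichain n k "bot_part n # Rs" using chain[OF Rs] .
      have "?S Ps = ?S Rs" using F(2)[OF Ps] F(2)[OF Rs] eq by simp
      then have "complements n (bot_part n # Ps) = complements n (bot_part n # Rs)"
        using shuffle_parts_inj[OF P.partition_on_complements R.partition_on_complements]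
          P.length_complements_eq R.length_complements_eq by simp
      then have "bot_part n # Ps = bot_part n # Rs"
        by (rule complements_inj[OF assms P.Ps R.Ps])
      then show "Ps = Rs" by simp
    qed
    show "?F ` multichains n (k - 1) = {P \<in> NC (k * n). \<forall>B\<in>P. card B = k}"
    proof (intro equalityI subsetI)
      fix P assume "P \<in> ?F ` multichains n (k - 1)"
      then obtain Ps where mem: "Ps \<in> multichains n (k - 1)" and P_eq: "P = ?F Ps" by blast
      interpret multichain n k "bot_part n # Ps" using chain[OF mem] .
      have "level 0 = bot_part n" using level_nth[of 0] assms by simp
      then show "P \<in> {P \<in> NC (k * n). \<forall>B\<in>P. card B = k}"
        using F[OF mem] block_sizes_iff_bottom_first[OF F[OF mem]] unfolding P_eq by simp
    next
      fix P assume "P \<in> {P \<in> NC (k * n). \<forall>B\<in>P. card B = k}"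
      then have P: "P \<in> NC (k * n)" and size: "\<forall>B\<in>P. card B = k" by auto
      have S: "kreweras (k * n) P \<in> NC (k * n)" using bij P by (auto simp: bij_betw_def)
      have "u mod k = v mod k" if "same_block (kreweras (k * n) P) u v" for u v
        using kreweras_residues_of_block_sizes[OF P _ that] size by blast
      then obtain L where L: "L \<in> multichains n k"
        "shuffle_parts (complements n L) = kreweras (k * n) P"
        using multichain_of_noncrossing_shuffle[OF assms S] by blast
      interpret multichain n k L using assms L by unfold_locales
      have "level 0 = bot_part n" using block_sizes_iff_bottom_first[OF P L(2)[symmetric]] size by blast
      moreover have "L \<noteq> []" using length_Ps assms by auto
      ultimately obtain Ps where L_eq: "L = bot_part n # Ps"
        using level_nth[of 0] assms by (cases L) auto
      have mem: "Ps \<in> multichains n (k - 1)"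
        using L(1) unfolding L_eq by (auto simp: multichains_def)
      have "kreweras (k * n) (?F Ps) = kreweras (k * n) P" using F(2)[OF mem] L(2) L_eq by simp
      then have "?F Ps = P"
        using bij F(1)[OF mem] P by (auto simp: bij_betw_def dest: inj_onD)
      then show "P \<in> ?F ` multichains n (k - 1)" using mem by blast
    qed
  qed
qed

end
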